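(* A minimal admissible homogeneous $SL_n(\mathbb R)$-manifold $M$ of class II is isomorphic to the manifold $M_{p,q}=SL_n(\mathbb R)/(SO_p\times SO_q)$ for some $p,q$ with $p+q=n$.
   Context: Lie groups and stability subgroups are connected. A homogeneous manifold $G/H$ with compact connected $H$ is admissible if it admits a $G$-invariant Lorentzian metric; it is minimal admissible if there is no connected compact subgroup $\tilde H$ containing $H$ properly with $G/\tilde H$ admissible. For $G=SL_n(\mathbb R)$, $K=SO_n$, with symmetric decomposition $\mathfrak g=\mathfrak k+\mathfrak p$ ($\mathfrak p$ = traceless symmetric matrices), an admissible manifold $G/H$, $H\subset K$, belongs to the class II if the space $\mathfrak p^H$ of $\mathrm{Ad}_H$-invariant vectors in $\mathfrak p$ is non-zero. In $M_{p,q}$, the subgroup $SO_p\times SO_q=SO(U)\times SO(W)\subset SO_n$ is the connected subgroup preserving an orthogonal decomposition $\mathbb R^n=U+W$ with $\dim U=p$, $\dim W=q$. *)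

theory Defs
  imports "HOL-Analysis.Analysis" "HOL-Algebra.Left_Coset"
begin

definition SL :: "(real^'n^'n) monoid" where
  "SL = \<lparr>carrier = {A. det A = 1}, mult = (**), one = mat 1\<rparr>"

definition SO :: "(real^'n^'n) set" where
  "SO = {A. rotation_matrix A}"

definition compact_connected_subgroup :: "(real^'n^'n) set \<Rightarrow> bool" where
  "compact_connected_subgroup H \<longleftrightarrow> subgroup H SL \<and> compact H \<and> connected H"

text \<open>For an open set \<open>S\<close>, the following is the usual class \<open>C\<^sup>k\<close>: differentiable, with all directional
  derivatives of class \<open>C\<^sup>k\<^sup>-\<^sup>1\<close>.\<close>

fun Ck_on :: "nat \<Rightarrow> ('a::euclidean_space \<Rightarrow> real) \<Rightarrow> 'a set \<Rightarrow> bool" where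
  "Ck_on 0 f S \<longleftrightarrow> continuous_on S f"
| "Ck_on (Suc k) f S \<longleftrightarrow>
     (\<forall>x\<in>S. f differentiable (at x)) \<and> (\<forall>v. Ck_on k (\<lambda>x. frechet_derivative f (at x) v) S)"

text \<open>\<open>SL\<close> is a closed embedded submanifold of the space of matrices, so that its smooth functions are
  the restrictions of smooth functions on open neighbourhoods.\<close>

definition smooth_on_SL :: "(real^'n^'n \<Rightarrow> real) \<Rightarrow> bool" where
  "smooth_on_SL f \<longleftrightarrow> (\<exists>V F. open V \<and> carrier SL \<subseteq> V \<and> (\<forall>k. Ck_on k F V) \<and>
     (\<forall>g\<in>carrier SL. F g = f g))"

text \<open>The points of the manifold \<open>G/H\<close>, for \<open>G = SL\<close>, are the left cosets \<open>gH\<close>. Its smooth structure is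
  the one for which the projection \<open>G \<rightarrow> G/H\<close> is a submersion: a function on \<open>G/H\<close> is smooth
  iff its pull-back to \<open>G\<close> is.\<close>

definition smooth_on_quotient :: "(real^'n^'n) set \<Rightarrow> ((real^'n^'n) set \<Rightarrow> real) \<Rightarrow> bool" where
  "smooth_on_quotient H f \<longleftrightarrow> smooth_on_SL (\<lambda>g. f (g <#\<^bsub>SL\<^esub> H))"

text \<open>Isomorphism of homogeneous manifolds is \<open>G\<close>-equivariant diffeomorphism; a bijection is a
  diffeomorphism iff composition with it preserves and reflects smoothness of functions.\<close>

definition isomorphic_quotients :: "(real^'n^'n) set \<Rightarrow> (real^'n^'n) set \<Rightarrow> bool" where
  "isomorphic_quotients H L \<longleftrightarrow> (\<exists>F. bij_betw F (lcosets\<^bsub>SL\<^esub> H) (lcosets\<^bsub>SL\<^esub> L) \<and>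
     (\<forall>g\<in>carrier SL. \<forall>C\<in>lcosets\<^bsub>SL\<^esub> H. F (g <#\<^bsub>SL\<^esub> C) = g <#\<^bsub>SL\<^esub> F C) \<and>
     (\<forall>f. smooth_on_quotient L f \<longleftrightarrow> smooth_on_quotient H (f \<circ> F)))"

text \<open>This is the usual tangent space when \<open>S\<close> is an embedded submanifold. It is applied only to \<open>SL\<close>
  and to cosets of compact subgroups.\<close>

definition tangent_space :: "'a::euclidean_space set \<Rightarrow> 'a \<Rightarrow> 'a set" where
  "tangent_space S x =
     {v. \<exists>\<gamma>. \<gamma> (0::real) = x \<and> range \<gamma> \<subseteq> S \<and> (\<gamma> has_vector_derivative v) (at 0)}"

text \<open>A tangent vector of \<open>G/H\<close> at the point \<open>aH\<close> is the image \<open>d\<pi>\<^sub>a X\<close> of a tangent vector \<open>X\<close> of \<open>G\<close> at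
  \<open>a\<close> under the differential of the projection \<open>\<pi> : G \<rightarrow> G/H\<close>. Since \<open>\<pi>\<close> is unchanged by right
  translation by \<open>h \<in> H\<close>, and the kernel of \<open>d\<pi>\<^sub>b\<close> is the tangent space of the fibre \<open>bH\<close>, one has
  \<open>d\<pi>\<^sub>a X = d\<pi>\<^sub>b Y\<close> iff \<open>b = ah\<close> for some \<open>h \<in> H\<close> and \<open>Y - Xh\<close> is tangent to \<open>bH\<close> at \<open>b\<close>. The vector
  \<open>d\<pi>\<^sub>a X\<close> is represented by the class of all such pairs \<open>(b, Y)\<close>.\<close>

type_synonym 'n quotient_tangent = "((real^'n^'n) \<times> (real^'n^'n)) set"

definition dproj :: "(real^'n^'n) set \<Rightarrow> real^'n^'n \<Rightarrow> real^'n^'n \<Rightarrow> 'n quotient_tangent" where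
  "dproj H a X =
     {(b, Y). \<exists>h\<in>H. b = a ** h \<and> Y - X ** h \<in> tangent_space (b <#\<^bsub>SL\<^esub> H) b}"

text \<open>A Lorentzian metric on \<open>G/H\<close> is a smooth family of symmetric bilinear forms of signature
  \<open>(-,+,\<dots>,+)\<close> on the tangent spaces: there is a timelike vector whose orthogonal complement is positive
  definite. Linearity and smoothness are expressed by pulling the metric back to \<open>G\<close>; smoothness is
  tested on the frames of left invariant vector fields \<open>a \<mapsto> aX\<close>.\<close>

definition lorentzian_metric ::
    "(real^'n^'n) set \<Rightarrow> ('n quotient_tangent \<Rightarrow> 'n quotient_tangent \<Rightarrow> real) \<Rightarrow> bool" where
  "lorentzian_metric H m \<longleftrightarrow>
     (\<forall>a\<in>carrier SL. \<forall>X\<in>tangent_space (carrier SL) a. \<forall>Y\<in>tangent_space (carrier SL) a.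
        m (dproj H a X) (dproj H a Y) = m (dproj H a Y) (dproj H a X)) \<and>
     (\<forall>a\<in>carrier SL. \<forall>X\<in>tangent_space (carrier SL) a. \<forall>Y\<in>tangent_space (carrier SL) a.
        \<forall>Z\<in>tangent_space (carrier SL) a. \<forall>r s.
        m (dproj H a (r *\<^sub>R X + s *\<^sub>R Y)) (dproj H a Z) =
          r * m (dproj H a X) (dproj H a Z) + s * m (dproj H a Y) (dproj H a Z)) \<and>
     (\<forall>a\<in>carrier SL. \<exists>X\<in>tangent_space (carrier SL) a.
        m (dproj H a X) (dproj H a X) < 0 \<and>
        (\<forall>Y\<in>tangent_space (carrier SL) a.
           dproj H a Y \<noteq> dproj H a 0 \<and> m (dproj H a X) (dproj H a Y) = 0 \<longrightarrow>
           m (dproj H a Y) (dproj H a Y) > 0)) \<and>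
     (\<forall>X\<in>tangent_space (carrier SL) (mat 1). \<forall>Y\<in>tangent_space (carrier SL) (mat 1).
        smooth_on_SL (\<lambda>a. m (dproj H a (a ** X)) (dproj H a (a ** Y))))"

text \<open>The differential of the left translation \<open>C \<mapsto> gC\<close> of \<open>G/H\<close> maps \<open>d\<pi>\<^sub>a X\<close> to
  \<open>d\<pi>\<^sub>g\<^sub>a (gX)\<close>.\<close>

definition invariant_metric ::
    "(real^'n^'n) set \<Rightarrow> ('n quotient_tangent \<Rightarrow> 'n quotient_tangent \<Rightarrow> real) \<Rightarrow> bool" where
  "invariant_metric H m \<longleftrightarrow>
     (\<forall>g\<in>carrier SL. \<forall>a\<in>carrier SL.
        \<forall>X\<in>tangent_space (carrier SL) a. \<forall>Y\<in>tangent_space (carrier SL) a.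
        m (dproj H (g ** a) (g ** X)) (dproj H (g ** a) (g ** Y)) =
        m (dproj H a X) (dproj H a Y))"

definition admissible :: "(real^'n^'n) set \<Rightarrow> bool" where
  "admissible H \<longleftrightarrow> compact_connected_subgroup H \<and>
     (\<exists>m. lorentzian_metric H m \<and> invariant_metric H m)"

definition minimal_admissible :: "(real^'n^'n) set \<Rightarrow> bool" where
  "minimal_admissible H \<longleftrightarrow> admissible H \<and>
     \<not> (\<exists>L. compact_connected_subgroup L \<and> H \<subset> L \<and> admissible L)"

definition traceless_symmetric :: "(real^'n^'n) set" where
  "traceless_symmetric = {X. transpose X = X \<and> trace X = 0}"

definition Ad_invariants :: "(real^'n^'n) set \<Rightarrow> (real^'n^'n) set" where
  "Ad_invariants H = {X \<in> traceless_symmetric. \<forall>h\<in>H. h ** X ** matrix_inv h = X}"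

definition class_II :: "(real^'n^'n) set \<Rightarrow> bool" where
  "class_II H \<longleftrightarrow> admissible H \<and> H \<subseteq> SO \<and> (\<exists>X\<in>Ad_invariants H. X \<noteq> 0)"

definition orthogonal_decomposition :: "(real^'n) set \<Rightarrow> (real^'n) set \<Rightarrow> bool" where
  "orthogonal_decomposition U W \<longleftrightarrow> subspace U \<and> subspace W \<and>
     (\<forall>u\<in>U. \<forall>w\<in>W. orthogonal u w) \<and> (\<forall>x. \<exists>u\<in>U. \<exists>w\<in>W. x = u + w)"

text \<open>\<open>SO(U)\<close> is embedded in the full rotation group by the identity on the orthogonal complement of
  \<open>U\<close>. Hence the determinant of a member is that of its restriction to \<open>U\<close>.\<close>

definition SO_sub :: "(real^'n) set \<Rightarrow> (real^'n^'n) set" where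
  "SO_sub U = {A \<in> SO. \<forall>x\<in>orthogonal_comp U. A *v x = x}"

definition SO_prod :: "(real^'n) set \<Rightarrow> (real^'n) set \<Rightarrow> (real^'n^'n) set" where
  "SO_prod U W = {A ** B | A B. A \<in> SO_sub U \<and> B \<in> SO_sub W}"

lemma orthogonal_decomposition_exists:
  assumes "p + q = CARD('n)"
  shows "\<exists>U W. orthogonal_decomposition U (W :: (real^'n) set) \<and> dim U = p \<and> dim W = q"
proof -
  have "p \<le> dim (UNIV :: (real^'n) set)"
    using assms by simp
  then obtain U :: "(real^'n) set" where U: "subspace U" "dim U = p"
    by (metis choose_subspace_of_subspace)
  define W where "W = orthogonal_comp U"
  have W: "subspace W"
    by (simp add: W_def subspace_orthogonal_comp)
  have "dim W + dim U = CARD('n)"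
    using dim_subspace_orthogonal_to_vectors[of U UNIV] U
    by (simp add: W_def orthogonal_comp_def)
  moreover have "\<exists>u\<in>U. \<exists>w\<in>W. x = u + w" for x
    using subspace_sum_orthogonal_comp[OF U(1)] W_def
    by (metis UNIV_I set_plus_elim)
  moreover have "\<forall>u\<in>U. \<forall>w\<in>W. orthogonal u w"
    by (simp add: W_def orthogonal_comp_def)
  ultimately show ?thesis
    using U W assms unfolding orthogonal_decomposition_def
    by (intro exI[of _ U] exI[of _ W]) auto
qed

text \<open>The next predicate says that \<open>G/H\<close> is isomorphic to \<open>M\<^sub>p\<^sub>,\<^sub>q = G/(SO\<^sub>p \<times> SO\<^sub>q)\<close>. That manifold is
  determined up to isomorphism by \<open>p\<close> and \<open>q\<close>; the isomorphism is required for every choice of the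
  decomposition, and a decomposition exists by the preceding lemma.\<close>

definition isomorphic_to_M :: "nat \<Rightarrow> nat \<Rightarrow> (real^'n^'n) set \<Rightarrow> bool" where
  "isomorphic_to_M p q H \<longleftrightarrow>
     (\<forall>U W. orthogonal_decomposition U W \<and> dim U = p \<and> dim W = q \<longrightarrow>
        isomorphic_quotients H (SO_prod U W))"

end

theory Submission
  imports Defs
begin

text \<open>
  Let \<open>X \<noteq> 0\<close> be a traceless symmetric matrix that commutes with \<open>H\<close>. A symmetric matrix has a real
  eigenvalue, and \<open>X\<close> is not scalar because its trace vanishes; so some eigenspace \<open>U\<close> of \<open>X\<close> and its
  complement \<open>W = U\<^sup>\<bottom>\<close> are both non-zero. \<open>H\<close> preserves \<open>U\<close> and \<open>W\<close>, and as \<open>H\<close> is connected, the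
  restrictions of its elements to \<open>U\<close> and \<open>W\<close> have determinant \<open>1\<close>. Hence
  \<open>H \<subseteq> L := SO(U) \<times> SO(W)\<close> (\<open>subset_SO_prod\<close>).

  The group \<open>L\<close> is itself compact and connected (\<open>compact_connected_SO_prod\<close>) and fixes the traceless
  part of the orthogonal projection onto \<open>U\<close>, a non-zero element of \<open>\<pp>\<close>
  (\<open>SO_prod_Ad_invariant\<close>). A group \<open>L \<subseteq> SO\<^sub>n\<close> with a unit fixed vector \<open>E \<in> \<pp>\<close> is admissible
  (\<open>admissible_if_Ad_invariant\<close>): let \<open>\<ll>\<close> be its Lie algebra and \<open>\<pi>\<close> the projection onto \<open>\<ll>\<^sup>\<bottom>\<close>
  for the Frobenius inner product. Then \<open>|\<pi> Y|\<^sup>2\<close> is an \<open>Ad\<^sub>L\<close>-invariant Riemannian form on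
  \<open>\<gg>/\<ll>\<close>, and \<open>|\<pi> Y|\<^sup>2 - 2 \<langle>E, Y\<rangle>\<^sup>2\<close> is obtained from it by reversing the sign on the line of \<open>E\<close>, so
  it is Lorentzian; it is invariant because \<open>E\<close> is, and well defined on \<open>\<gg>/\<ll>\<close> because
  the symmetric \<open>E\<close> is orthogonal to \<open>\<ll>\<close>, which consists of skew matrices. Left translation spreads
  it over \<open>G/L\<close>.

  Minimality of \<open>H\<close> therefore gives \<open>H = L\<close>. Finally, for another decomposition \<open>U' + W'\<close> with the same
  dimensions there is a rotation \<open>k\<close> that carries \<open>U\<close> to \<open>U'\<close> and \<open>W\<close> to \<open>W'\<close>. It conjugates \<open>L\<close> into
  \<open>SO(U') \<times> SO(W')\<close>, and right translation by \<open>k\<^sup>-\<^sup>1\<close> induces the isomorphism of the quotients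
  (\<open>isomorphic_quotients_conjugate\<close>).
\<close>

section \<open>Matrix multiplication, the Frobenius inner product and projections\<close>

lemma bounded_bilinear_matrix_mult: "bounded_bilinear ((**) :: real^'n^'n \<Rightarrow> real^'n^'n \<Rightarrow> real^'n^'n)"
proof -
  have "bilinear ((**) :: real^'n^'n \<Rightarrow> real^'n^'n \<Rightarrow> real^'n^'n)"
    unfolding bilinear_def
    by (auto intro!: linearI
        simp: matrix_matrix_mult_def vec_eq_iff sum.distrib algebra_simps sum_distrib_left)
  then show ?thesis
    by (simp add: bilinear_conv_bounded_bilinear)
qed

lemmas matrix_mult_simps =
  bounded_bilinear.add_left[OF bounded_bilinear_matrix_mult]
  bounded_bilinear.add_right[OF bounded_bilinear_matrix_mult]
  bounded_bilinear.diff_left[OF bounded_bilinear_matrix_mult]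
  bounded_bilinear.diff_right[OF bounded_bilinear_matrix_mult]
  bounded_bilinear.scaleR_left[OF bounded_bilinear_matrix_mult]
  bounded_bilinear.scaleR_right[OF bounded_bilinear_matrix_mult]
  bounded_bilinear.zero_left[OF bounded_bilinear_matrix_mult]
  bounded_bilinear.zero_right[OF bounded_bilinear_matrix_mult]

lemmas continuous_on_matrix_mult =
  bounded_bilinear.continuous_on[OF bounded_bilinear_matrix_mult]

lemmas bounded_linear_mult_left = bounded_bilinear.bounded_linear_right[OF bounded_bilinear_matrix_mult]

lemmas bounded_linear_mult_right = bounded_bilinear.bounded_linear_left[OF bounded_bilinear_matrix_mult]

lemma continuous_on_det: "continuous_on S (det :: real^'n^'n \<Rightarrow> real)"
  unfolding det_def by (intro continuous_intros)

lemma linear_transpose: "linear (transpose :: real^'n^'n \<Rightarrow> real^'n^'n)"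
  by (rule linearI) (simp_all add: transpose_def vec_eq_iff)

lemma inner_matrix_vector: "(A *v x) \<bullet> y = x \<bullet> (transpose A *v y)" for A :: "real^'n^'n"
  by (metis dot_lmul_matrix vector_transpose_matrix)

lemma inner_matrix_trace: "A \<bullet> B = trace (transpose A ** B)" for A B :: "real^'n^'n"
  unfolding inner_vec_def trace_def matrix_matrix_mult_def transpose_def
  by simp (rule sum.swap)

lemma inner_transpose: "transpose A \<bullet> transpose B = A \<bullet> B" for A B :: "real^'n^'n"
  unfolding inner_vec_def transpose_def by simp (rule sum.swap)

lemma inner_symmetric_skew:
  fixes A B :: "real^'n^'n"
  assumes "transpose A = A" "transpose B = - B"
  shows "A \<bullet> B = 0"
  using inner_transpose[of A B] assms by simp

lemma orthogonal_matrix_iff_inner: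
  "orthogonal_matrix A \<longleftrightarrow> (\<forall>x y. (A *v x) \<bullet> (A *v y) = x \<bullet> y)" for A :: "real^'n^'n"
  using orthogonal_transformation_matrix[of "(*v) A"]
  by (simp add: orthogonal_transformation_def)

lemma matrix_inv_mult:
  fixes A :: "real^'n^'n"
  assumes "det A = 1"
  shows "matrix_inv A ** A = mat 1" "A ** matrix_inv A = mat 1"
    and "matrix_inv A ** (A ** B) = B" "A ** (matrix_inv A ** B) = B"
    and "(B ** matrix_inv A) ** A = B" "(B ** A) ** matrix_inv A = B"
    and "det (matrix_inv A) = 1"
proof -
  have "invertible A"
    using assms by (simp add: invertible_det_nz)
  then have *: "A ** matrix_inv A = mat 1 \<and> matrix_inv A ** A = mat 1"
    unfolding invertible_def matrix_inv_def by (rule someI_ex)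
  then show "matrix_inv A ** A = mat 1" "A ** matrix_inv A = mat 1" by auto
  then show "matrix_inv A ** (A ** B) = B" "A ** (matrix_inv A ** B) = B"
    "(B ** matrix_inv A) ** A = B" "(B ** A) ** matrix_inv A = B"
    by (simp_all add: matrix_mul_assoc) (simp_all add: matrix_mul_assoc[symmetric])
  from * have "det A * det (matrix_inv A) = 1"
    by (metis det_I det_mul)
  with assms show "det (matrix_inv A) = 1" by simp
qed

lemma matrix_inv_unique:
  fixes A B :: "real^'n^'n"
  assumes "A ** B = mat 1"
  shows "matrix_inv A = B"
proof -
  have BA: "B ** A = mat 1"
    using assms by (simp add: matrix_left_right_inverse)
  then have "invertible A" using assms unfolding invertible_def by blast
  then have "matrix_inv A ** A = mat 1"
    unfolding invertible_def matrix_inv_def by (metis (mono_tags, lifting) someI_ex)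
  then show ?thesis
    by (metis assms matrix_mul_assoc matrix_mul_lid matrix_mul_rid)
qed

lemma matrix_inv_product:
  fixes A B :: "real^'n^'n"
  assumes "det A = 1" "det B = 1"
  shows "matrix_inv (A ** B) = matrix_inv B ** matrix_inv A"
  by (rule matrix_inv_unique)
    (simp add: matrix_mul_assoc matrix_inv_mult[OF assms(1)] matrix_inv_mult[OF assms(2)])

lemma matrix_inv_matrix_inv:
  fixes A :: "real^'n^'n"
  assumes "det A = 1"
  shows "matrix_inv (matrix_inv A) = A"
  by (rule matrix_inv_unique) (rule matrix_inv_mult(1)[OF assms])

text \<open>The projection is applied to subspaces of \<open>\<real>\<^sup>n\<close> and to Lie algebras in the space of matrices. The last
  property, that \<open>\<pi> x\<close> is the only candidate, is what gives linearity and, later, equivariance.\<close>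

lemma orthogonal_projection_exists:
  fixes T :: "'a::euclidean_space set"
  assumes T: "subspace T"
  obtains \<pi> where "linear \<pi>" "\<And>x. x - \<pi> x \<in> T" "\<And>x t. t \<in> T \<Longrightarrow> \<pi> x \<bullet> t = 0"
    "\<And>x y. x - y \<in> T \<Longrightarrow> (\<And>t. t \<in> T \<Longrightarrow> y \<bullet> t = 0) \<Longrightarrow> \<pi> x = y"
proof -
  have "\<exists>y. x - y \<in> T \<and> (\<forall>t\<in>T. y \<bullet> t = 0)" for x
  proof -
    obtain t y where "t \<in> span T" "\<And>w. w \<in> span T \<Longrightarrow> orthogonal y w" "x = t + y"
      using orthogonal_subspace_decomp_exists[of T x] by metis
    then show ?thesis
      by (intro exI[of _ y]) (auto simp: orthogonal_def span_base span_eq_iff[THEN iffD2, OF T])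
  qed
  then obtain \<pi> where \<pi>: "\<And>x. x - \<pi> x \<in> T" "\<And>x t. t \<in> T \<Longrightarrow> \<pi> x \<bullet> t = 0" by metis
  have uniq: "\<pi> x = y" if "x - y \<in> T" "\<And>t. t \<in> T \<Longrightarrow> y \<bullet> t = 0" for x y
  proof -
    have "(x - y) - (x - \<pi> x) \<in> T" by (rule subspace_diff[OF T that(1) \<pi>(1)])
    then have "\<pi> x - y \<in> T" by simp
    then have "(\<pi> x - y) \<bullet> (\<pi> x - y) = 0"
      using \<pi>(2) that(2) by (subst inner_diff_left) simp
    then show ?thesis by simp
  qed
  have "linear \<pi>"
  proof (rule linearI)
    show "\<pi> (x + y) = \<pi> x + \<pi> y" for x y
    proof (rule uniq)
      have "(x - \<pi> x) + (y - \<pi> y) \<in> T" by (intro subspace_add[OF T] \<pi>)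
      then show "x + y - (\<pi> x + \<pi> y) \<in> T" by (simp add: algebra_simps)
    qed (simp add: inner_add_left \<pi>)
    show "\<pi> (c *\<^sub>R x) = c *\<^sub>R \<pi> x" for c x
      by (rule uniq) (simp_all add: \<pi> subspace_scale[OF T] flip: scaleR_diff_right)
  qed
  from that[OF this \<pi> uniq] show ?thesis .
qed

text \<open>The Rayleigh quotient argument: let \<open>f x = \<langle>x, X x\<rangle>\<close> attain its maximum over the unit sphere at \<open>u\<close>.
  Then \<open>f u |x|\<^sup>2 - f x\<close> is a positive semidefinite quadratic form that vanishes at \<open>u\<close>, so \<open>u\<close> lies in
  its kernel, which says \<open>X u = f u \<cdot> u\<close>.\<close>

lemma symmetric_eigenvector:
  fixes X :: "real^'n^'n"
  assumes "transpose X = X"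
  obtains r u where "u \<noteq> 0" "X *v u = r *\<^sub>R u"
proof -
  define f where "f = (\<lambda>x. x \<bullet> (X *v x))"
  obtain k :: 'n where True by blast
  have "axis k 1 \<in> sphere (0 :: real^'n) 1" by (simp add: norm_axis_1)
  moreover have "continuous_on (sphere 0 1) f"
    unfolding f_def matrix_vector_mult_def by (intro continuous_intros)
  ultimately obtain u where u: "u \<in> sphere 0 1" "\<And>x. x \<in> sphere 0 1 \<Longrightarrow> f x \<le> f u"
    using continuous_attains_sup[of "sphere 0 1" f] by (metis compact_sphere empty_iff)
  have uu: "u \<bullet> u = 1" using u(1) by (simp add: norm_eq_1)
  have pos: "f x \<le> f u * (x \<bullet> x)" for x
  proof (cases "x = 0")
    case False
    then have "x /\<^sub>R norm x \<in> sphere 0 1" by simp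
    from u(2)[OF this] have "f x / (norm x)\<^sup>2 \<le> f u"
      by (simp add: f_def matrix_vector_mult_scaleR power2_eq_square divide_simps)
    then show ?thesis using False by (simp add: field_simps power2_norm_eq_inner)
  qed (simp add: f_def)
  define w where "w = f u *\<^sub>R u - X *v u"
  have sym: "x \<bullet> (X *v y) = y \<bullet> (X *v x)" for x y
    using inner_matrix_vector[of X x y] assms by (simp add: inner_commute)
  define g where "g = f u * (w \<bullet> w) - f w"
  have g: "g \<ge> 0" using pos[of w] by (simp add: g_def)
  \<comment> \<open>Positivity at \<open>u - t w\<close>; the term linear in \<open>t\<close> forces \<open>w = 0\<close>.\<close>
  have quad: "0 \<le> t\<^sup>2 * g - 2 * t * (w \<bullet> w)" for t
  proof -
    have 1: "f (u - t *\<^sub>R w) = f u - 2 * t * (w \<bullet> (X *v u)) + t\<^sup>2 * f w"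
      using sym[of u w]
      by (simp add: f_def matrix_vector_mult_diff_distrib matrix_vector_mult_scaleR inner_diff_left
          inner_diff_right power2_eq_square algebra_simps)
    have 2: "(u - t *\<^sub>R w) \<bullet> (u - t *\<^sub>R w) = 1 - 2 * t * (w \<bullet> u) + t\<^sup>2 * (w \<bullet> w)"
      by (simp add: uu inner_diff_left inner_diff_right power2_eq_square inner_commute algebra_simps)
    have "w \<bullet> (f u *\<^sub>R u - X *v u) = f u * (w \<bullet> u) - w \<bullet> (X *v u)"
      by (simp add: inner_diff_right)
    then have 3: "f u * (w \<bullet> u) - w \<bullet> (X *v u) = w \<bullet> w"
      by (simp flip: w_def)
    have "0 \<le> f u * (1 - 2 * t * (w \<bullet> u) + t\<^sup>2 * (w \<bullet> w))
        - (f u - 2 * t * (w \<bullet> (X *v u)) + t\<^sup>2 * f w)"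
      using pos[of "u - t *\<^sub>R w"] unfolding 1 2 by linarith
    also have "\<dots> = t\<^sup>2 * g - 2 * t * (f u * (w \<bullet> u) - w \<bullet> (X *v u))"
      by (simp add: g_def algebra_simps)
    finally show ?thesis unfolding 3 .
  qed
  have "w \<bullet> w = 0"
  proof (rule ccontr)
    assume "w \<bullet> w \<noteq> 0"
    then have ww: "w \<bullet> w > 0" using inner_ge_zero[of w] by linarith
    \<comment> \<open>Small enough for the linear term to dominate; \<open>g + 1\<close> instead of \<open>g\<close> avoids a division by \<open>0\<close>.\<close>
    define t where "t = (w \<bullet> w) / (g + 1)"
    have t: "t > 0" "t * (g + 1) = w \<bullet> w" using ww g by (simp_all add: t_def)
    then have "t * g + t = w \<bullet> w" by (simp add: algebra_simps)
    then have "t * g < 2 * (w \<bullet> w)" using t(1) ww by linarith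
    then have "t * (t * g) < t * (2 * (w \<bullet> w))" using t(1) by (simp only: mult_less_cancel_left_pos)
    then show False using quad[of t] by (simp add: power2_eq_square algebra_simps)
  qed
  then have "X *v u = f u *\<^sub>R u" by (simp add: w_def)
  moreover have "u \<noteq> 0" using uu by auto
  ultimately show ?thesis using that by blast
qed

section \<open>The special linear group and the rotation group\<close>

lemma carrier_SL [simp]: "A \<in> carrier SL \<longleftrightarrow> det A = 1"
  by (simp add: SL_def)

lemma mult_SL [simp]: "A \<otimes>\<^bsub>SL\<^esub> B = A ** B"
  by (simp add: SL_def)

lemma one_SL [simp]: "\<one>\<^bsub>SL\<^esub> = mat 1"
  by (simp add: SL_def)

lemma l_coset_SL: "a <#\<^bsub>SL\<^esub> H = (**) a ` H"
  by (auto simp: l_coset_def)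

lemma group_SL: "group (SL :: (real^'n^'n) monoid)"
proof (rule groupI)
  fix x :: "real^'n^'n" assume "x \<in> carrier SL"
  then show "\<exists>y\<in>carrier SL. y \<otimes>\<^bsub>SL\<^esub> x = \<one>\<^bsub>SL\<^esub>"
    by (intro bexI[of _ "matrix_inv x"]) (auto simp: matrix_inv_mult)
qed (auto simp: det_mul matrix_mul_assoc)

lemma inv_SL:
  assumes "det A = 1"
  shows "inv\<^bsub>SL\<^esub> A = matrix_inv A"
  using group.inv_equality[OF group_SL, of "matrix_inv A" A] assms
  by (simp add: matrix_inv_mult)

lemma subgroup_SL_iff:
  fixes H :: "(real^'n^'n) set"
  shows "subgroup H SL \<longleftrightarrow> H \<subseteq> {A. det A = 1} \<and> mat 1 \<in> H \<and> (\<forall>A\<in>H. \<forall>B\<in>H. A ** B \<in> H) \<and>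
     (\<forall>A\<in>H. matrix_inv A \<in> H)"
proof -
  have "(\<forall>A\<in>H. inv\<^bsub>SL\<^esub> A \<in> H) \<longleftrightarrow> (\<forall>A\<in>H. matrix_inv A \<in> H)" if "H \<subseteq> {A. det A = 1}"
    using that inv_SL by (metis (mono_tags, lifting) mem_Collect_eq subset_iff)
  moreover have "carrier SL = {A :: real^'n^'n. det A = 1}" by auto
  ultimately show ?thesis
    unfolding subgroup_def mult_SL one_SL by blast
qed

lemma subgroup_SL_D:
  assumes "subgroup H SL"
  shows "h \<in> H \<Longrightarrow> det h = 1" "mat 1 \<in> H" "h \<in> H \<Longrightarrow> g \<in> H \<Longrightarrow> h ** g \<in> H"
    "h \<in> H \<Longrightarrow> matrix_inv h \<in> H"
proof -
  show "h \<in> H \<Longrightarrow> det h = 1" "mat 1 \<in> H" "h \<in> H \<Longrightarrow> g \<in> H \<Longrightarrow> h ** g \<in> H"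
    "h \<in> H \<Longrightarrow> matrix_inv h \<in> H"
    using subgroup_SL_iff[THEN iffD1, OF assms] by blast+
qed

lemma SO_D:
  assumes "A \<in> SO"
  shows "det A = 1" "orthogonal_matrix A" "matrix_inv A = transpose A"
    "A ** transpose A = mat 1" "transpose A ** A = mat 1"
  using assms by (auto simp: SO_def rotation_matrix_def orthogonal_matrix_def intro!: matrix_inv_unique)

lemma SO_I: "orthogonal_matrix A \<Longrightarrow> det A = 1 \<Longrightarrow> A \<in> SO"
  by (simp add: SO_def rotation_matrix_def)

lemma SO_inner: "A \<in> SO \<Longrightarrow> (A *v x) \<bullet> (A *v y) = x \<bullet> y"
  using SO_D(2) orthogonal_matrix_iff_inner by blast

lemma SO_mult: "A \<in> SO \<Longrightarrow> B \<in> SO \<Longrightarrow> A ** B \<in> SO"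
  by (simp add: SO_def rotation_matrix_def orthogonal_matrix_mul det_mul)

lemma SO_transpose: "A \<in> SO \<Longrightarrow> transpose A \<in> SO"
  by (simp add: SO_def rotation_matrix_def)

lemma SO_one: "mat 1 \<in> SO"
  by (simp add: SO_def rotation_matrix_def orthogonal_matrix_id)

text \<open>Boundedness holds because every orthogonal matrix has Frobenius norm \<open>\<surd>n\<close>.\<close>

lemma compact_SO: "compact (SO :: (real^'n^'n) set)"
proof -
  have "closed ({A. transpose A ** A = mat 1} \<inter> {A :: real^'n^'n. det A = 1})"
    by (intro closed_Int closed_Collect_eq continuous_on_matrix_mult continuous_intros
        linear_continuous_on[OF linear_linear[THEN iffD2, OF linear_transpose]] continuous_on_det)
  moreover have "SO = {A. transpose A ** A = mat 1} \<inter> {A :: real^'n^'n. det A = 1}"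
    by (auto simp: SO_def rotation_matrix_def orthogonal_matrix)
  moreover have "norm A = sqrt (real CARD('n))" if "A \<in> SO" for A :: "real^'n^'n"
    using SO_D(5)[OF that] by (simp add: norm_eq_sqrt_inner inner_matrix_trace trace_I)
  then have "bounded (SO :: (real^'n^'n) set)"
    unfolding bounded_iff by (metis order_refl)
  ultimately show ?thesis
    by (simp add: compact_eq_bounded_closed)
qed

lemma inner_SO_left: "h \<in> SO \<Longrightarrow> (h ** A) \<bullet> (h ** B) = A \<bullet> B" for A B :: "real^'n^'n"
proof -
  assume h: "h \<in> SO"
  have "transpose (h ** A) ** (h ** B) = transpose A ** (transpose h ** h) ** B"
    by (simp add: matrix_transpose_mul matrix_mul_assoc)
  then show ?thesis by (simp add: inner_matrix_trace SO_D[OF h])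
qed

lemma inner_SO_conjugate:
  fixes A B :: "real^'n^'n"
  assumes h: "h \<in> SO"
  shows "(h ** A ** matrix_inv h) \<bullet> (h ** B ** matrix_inv h) = A \<bullet> B"
proof -
  have "(C ** matrix_inv h) \<bullet> (D ** matrix_inv h) = C \<bullet> D" for C D :: "real^'n^'n"
    using inner_SO_left[OF h, of "transpose C" "transpose D"]
      inner_transpose[of "C ** matrix_inv h" "D ** matrix_inv h"]
    by (simp add: matrix_transpose_mul SO_D(3)[OF h] inner_transpose)
  then show ?thesis using inner_SO_left[OF h] by simp
qed

section \<open>Reflections\<close>

definition reflection :: "real^'n \<Rightarrow> real^'n^'n" where
  "reflection v = (\<chi> i j. (if i = j then 1 else 0) - 2 * v$i * v$j / (v \<bullet> v))"

lemma reflection_apply: "reflection v *v x = x - (2 * (x \<bullet> v) / (v \<bullet> v)) *\<^sub>R v"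
proof -
  have "(\<Sum>j\<in>UNIV. ((if i = j then 1 else 0) - 2 * v$i * v$j / (v \<bullet> v)) * x$j) =
      x$i - (2 * (\<Sum>j\<in>UNIV. x$j * v$j) / (v \<bullet> v)) * v$i" for i
    by (simp add: left_diff_distrib sum_subtractf sum_distrib_left sum_divide_distrib
        sum_distrib_right mult_delta_left) (simp add: mult_ac)
  then show ?thesis
    by (simp add: reflection_def matrix_vector_mult_def vec_eq_iff inner_vec_def)
qed

lemma reflection_involution:
  assumes "v \<noteq> 0"
  shows "reflection v ** reflection v = mat 1"
  using assms
  by (simp add: matrix_eq matrix_vector_mul_assoc[symmetric] reflection_apply inner_diff_left
      field_simps)

lemma transpose_reflection: "transpose (reflection v) = reflection v"
  by (simp add: reflection_def transpose_def vec_eq_iff mult.commute mult.left_commute)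

lemma orthogonal_reflection: "v \<noteq> 0 \<Longrightarrow> orthogonal_matrix (reflection v)"
  by (simp add: orthogonal_matrix transpose_reflection reflection_involution)

lemma reflection_minus: "reflection (- v) = reflection v"
  by (simp add: reflection_def)

text \<open>Some orthogonal \<open>M\<close> takes a coordinate vector \<open>e\<close> to the direction of \<open>v\<close>; it conjugates the reflection
  in \<open>e\<close>, which is diagonal, into the reflection in \<open>v\<close>.\<close>

lemma det_reflection:
  fixes v :: "real^'n"
  assumes "v \<noteq> 0"
  shows "det (reflection v) = -1"
proof -
  obtain k :: 'n where True by blast
  define e :: "real^'n" where "e = axis k 1"
  have "norm (v /\<^sub>R norm v) = 1" using assms by simp
  then obtain M where M: "orthogonal_matrix M" "M *v e = v /\<^sub>R norm v"
    using orthogonal_matrix_exists_basis unfolding e_def by metis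
  have Me: "v = norm v *\<^sub>R (M *v e)" using M(2) assms by simp
  have ee: "e \<bullet> e = 1" by (simp add: e_def inner_axis_axis)
  have "M ** reflection e *v x = reflection v ** M *v x" for x
  proof -
    have "(M *v x) \<bullet> v = norm v * (x \<bullet> e)"
      by (subst Me) (simp add: orthogonal_matrix_iff_inner[THEN iffD1, OF M(1)])
    then have "(2 * ((M *v x) \<bullet> v) / (v \<bullet> v)) *\<^sub>R v = (2 * (x \<bullet> e)) *\<^sub>R (M *v e)"
      by (subst (3) Me) (use assms in \<open>simp add: power2_norm_eq_inner[symmetric] power2_eq_square\<close>)
    then show ?thesis
      by (simp add: matrix_vector_mul_assoc[symmetric] reflection_apply ee
          matrix_vector_mult_diff_distrib matrix_vector_mult_scaleR)
  qed
  then have "M ** reflection e = reflection v ** M"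
    by (simp add: matrix_eq)
  then have "det M * det (reflection e) = det (reflection v) * det M"
    by (metis det_mul)
  moreover have "det M \<noteq> 0" using det_orthogonal_matrix[OF M(1)] by auto
  moreover have "det (reflection e) = (\<Prod>i\<in>UNIV. reflection e $ i $ i)"
    by (rule det_diagonal) (auto simp: reflection_def e_def axis_def)
  moreover have "(\<Prod>i\<in>UNIV. reflection e $ i $ i) = (\<Prod>i\<in>UNIV. if i = k then -1 else 1)"
    by (rule prod.cong) (simp_all add: reflection_def ee, auto simp: e_def axis_def)
  ultimately have "(det (reflection v) + 1) * det M = 0" "det M \<noteq> 0"
    by (simp_all add: algebra_simps)
  then show ?thesis by simp
qed

lemma continuous_on_reflection:
  assumes "continuous_on S c" "\<And>t. t \<in> S \<Longrightarrow> c t \<noteq> 0"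
  shows "continuous_on S (\<lambda>t. reflection (c t))"
  unfolding reflection_def
  by (intro continuous_intros assms) (use assms in auto)

text \<open>The step of the Cartan--Dieudonne theorem. As \<open>x\<close> and \<open>A x\<close> have the same length, the reflection in
  \<open>v = A x - x\<close> exchanges them, so composing it with \<open>A\<close> makes \<open>x\<close> a fixed point. No fixed point of \<open>A\<close>
  is lost, because \<open>v\<close> is orthogonal to all of them.\<close>

lemma reflection_shrinks:
  fixes A :: "real^'n^'n"
  assumes A: "orthogonal_matrix A" and x: "A *v x \<noteq> x"
  defines "v \<equiv> A *v x - x"
  shows "reflection v ** A *v x = x" "\<And>y. A *v y = y \<Longrightarrow> v \<bullet> y = 0"
    "\<And>y. A *v y = y \<Longrightarrow> reflection v ** A *v y = y"
    "orthogonal_matrix (reflection v ** A)"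
    "dim {y. A *v y = y} < dim {y. reflection v ** A *v y = y}"
proof -
  have iA: "(A *v a) \<bullet> (A *v b) = a \<bullet> b" for a b
    using A orthogonal_matrix_iff_inner by blast
  have v: "v \<noteq> 0" using x by (simp add: v_def)
  have "v \<bullet> v = 2 * ((A *v x) \<bullet> v)"
    by (simp add: v_def inner_diff_left inner_diff_right iA inner_commute)
  moreover have "v \<bullet> v \<noteq> 0" using v by simp
  ultimately have "2 * ((A *v x) \<bullet> v) / (v \<bullet> v) = 1" by (metis divide_self)
  then have "reflection v *v (A *v x) = A *v x - v"
    by (simp only: reflection_apply scaleR_one)
  then show Ax: "reflection v ** A *v x = x"
    by (simp add: matrix_vector_mul_assoc[symmetric] v_def)
  show y0: "v \<bullet> y = 0" if "A *v y = y" for y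
    using iA[of x y] that by (simp add: v_def inner_diff_left)
  show Ay: "reflection v ** A *v y = y" if "A *v y = y" for y
    using y0[OF that] that
    by (simp add: matrix_vector_mul_assoc[symmetric] reflection_apply inner_commute)
  show "orthogonal_matrix (reflection v ** A)"
    by (intro orthogonal_matrix_mul orthogonal_reflection v A)
  have sub: "subspace {y. B *v y = y}" for B :: "real^'n^'n"
    by (auto simp: subspace_def matrix_vector_right_distrib matrix_vector_mult_scaleR)
  have "{y. A *v y = y} \<subset> {y. reflection v ** A *v y = y}"
    using Ax Ay x by blast
  then show "dim {y. A *v y = y} < dim {y. reflection v ** A *v y = y}"
    by (intro dim_psubset) (simp only: span_eq_iff[THEN iffD2, OF sub])
qed

section \<open>Orthogonal decompositions\<close>

lemma orthogonal_decomposition_subspace: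
  "orthogonal_decomposition U W \<Longrightarrow> subspace U" "orthogonal_decomposition U W \<Longrightarrow> subspace W"
  by (simp_all add: orthogonal_decomposition_def)

lemma orthogonal_decomposition_inner:
  "orthogonal_decomposition U W \<Longrightarrow> u \<in> U \<Longrightarrow> w \<in> W \<Longrightarrow> u \<bullet> w = 0"
  by (simp add: orthogonal_decomposition_def orthogonal_def)

lemma orthogonal_decomposition_sum:
  assumes "orthogonal_decomposition U W"
  obtains u w where "u \<in> U" "w \<in> W" "x = u + w"
  using assms unfolding orthogonal_decomposition_def by blast

lemma orthogonal_decomposition_sym:
  assumes "orthogonal_decomposition U W"
  shows "orthogonal_decomposition W U"
  unfolding orthogonal_decomposition_def
proof (intro conjI ballI allI)
  show "subspace W" "subspace U" using assms orthogonal_decomposition_subspace by blast+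
  show "orthogonal w u" if "w \<in> W" "u \<in> U" for w u
    using orthogonal_decomposition_inner[OF assms that(2,1)] by (simp add: orthogonal_def inner_commute)
  show "\<exists>w\<in>W. \<exists>u\<in>U. x = w + u" for x
    by (metis assms orthogonal_decomposition_sum add.commute)
qed

text \<open>Each summand determines the other, so that membership in a summand can be checked by orthogonality.\<close>

lemma orthogonal_decomposition_comp:
  assumes "orthogonal_decomposition U W"
  shows "orthogonal_comp U = W"
proof
  show "W \<subseteq> orthogonal_comp U"
    using orthogonal_decomposition_inner[OF assms]
    by (simp add: subset_iff orthogonal_comp_def orthogonal_def)
  show "orthogonal_comp U \<subseteq> W"
  proof
    fix x assume x: "x \<in> orthogonal_comp U"
    obtain u w where uw: "u \<in> U" "w \<in> W" "x = u + w"
      using orthogonal_decomposition_sum[OF assms] by metis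
    have "u \<bullet> x = 0" "u \<bullet> w = 0"
      using x uw orthogonal_decomposition_inner[OF assms]
      by (simp_all add: orthogonal_comp_def orthogonal_def)
    then have "u = 0" using uw by (simp add: inner_add_right)
    then show "x \<in> W" using uw by simp
  qed
qed

lemma orthogonal_decomposition_memI:
  assumes "orthogonal_decomposition U W" "\<And>w. w \<in> W \<Longrightarrow> x \<bullet> w = 0"
  shows "x \<in> U"
  using orthogonal_decomposition_comp[OF orthogonal_decomposition_sym[OF assms(1)]] assms(2)
  by (auto simp: orthogonal_comp_def orthogonal_def inner_commute)

lemma matrix_eq_on_decomposition:
  fixes A B :: "real^'n^'n"
  assumes "orthogonal_decomposition U W"
    and "\<And>u. u \<in> U \<Longrightarrow> A *v u = B *v u" "\<And>w. w \<in> W \<Longrightarrow> A *v w = B *v w"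
  shows "A = B"
  unfolding matrix_eq
proof
  fix x
  obtain u w where "u \<in> U" "w \<in> W" "x = u + w"
    using orthogonal_decomposition_sum[OF assms(1)] by metis
  then show "A *v x = B *v x"
    using assms by (simp add: matrix_vector_right_distrib)
qed

lemma orthogonal_decomposition_projection:
  fixes U W :: "(real^'n) set"
  assumes od: "orthogonal_decomposition U W"
  obtains P where "\<And>u. u \<in> U \<Longrightarrow> P *v u = u" "\<And>w. w \<in> W \<Longrightarrow> P *v w = 0" "transpose P = P"
proof -
  obtain \<pi> where lin: "linear \<pi>" and \<pi>: "\<And>x. x - \<pi> x \<in> W" "\<And>x t. t \<in> W \<Longrightarrow> \<pi> x \<bullet> t = 0"
    and uniq: "\<And>x y. x - y \<in> W \<Longrightarrow> (\<And>t. t \<in> W \<Longrightarrow> y \<bullet> t = 0) \<Longrightarrow> \<pi> x = y"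
    using orthogonal_projection_exists[OF orthogonal_decomposition_subspace(2)[OF od]] by blast
  define P where "P = matrix \<pi>"
  have P: "P *v x = \<pi> x" for x
    using lin by (simp add: P_def)
  have U: "\<pi> u = u" if "u \<in> U" for u
    using orthogonal_decomposition_inner[OF od that]
      subspace_0[OF orthogonal_decomposition_subspace(2)[OF od]] by (intro uniq) simp_all
  have W: "\<pi> w = 0" if "w \<in> W" for w
    using that by (intro uniq) simp_all
  have "\<pi> x \<bullet> y = x \<bullet> \<pi> y" for x y
  proof -
    have "\<pi> x \<bullet> (y - \<pi> y) = 0" "\<pi> y \<bullet> (x - \<pi> x) = 0" using \<pi> by blast+
    then show ?thesis by (simp add: inner_diff_right inner_commute)
  qed
  then have "(transpose P *v x) \<bullet> y = (P *v x) \<bullet> y" for x y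
    by (subst inner_matrix_vector) (simp add: P)
  then have "transpose P = P"
    unfolding matrix_eq using vector_eq_rdot by blast
  then show ?thesis using that[of P] P U W by simp
qed

lemma transpose_maps_complement:
  fixes k :: "real^'n^'n"
  assumes od: "orthogonal_decomposition U W" and od': "orthogonal_decomposition U' W'"
    and k: "\<And>u. u \<in> U \<Longrightarrow> k *v u \<in> U'" and w: "w \<in> W'"
  shows "transpose k *v w \<in> W"
proof (rule orthogonal_decomposition_memI[OF orthogonal_decomposition_sym[OF od]])
  fix u assume "u \<in> U"
  then have "(k *v u) \<bullet> w = 0"
    using orthogonal_decomposition_inner[OF od' k w] by blast
  then show "(transpose k *v w) \<bullet> u = 0"
    using inner_matrix_vector[of k u w] by (metis inner_commute)
qed

text \<open>An isometry \<open>U \<rightarrow> U'\<close> and an isometry \<open>W \<rightarrow> W'\<close> add up to an orthogonal map of the whole space. Should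
  its determinant be \<open>-1\<close>, a reflection in a vector of \<open>U\<close> is applied first; it preserves \<open>U\<close> and \<open>W\<close>.
  This is why \<open>U\<close> is required to be non-zero.\<close>

lemma rotation_of_decompositions:
  fixes U W U' W' :: "(real^'n) set"
  assumes od: "orthogonal_decomposition U W" and od': "orthogonal_decomposition U' W'"
    and dims: "dim U = dim U'" "dim W = dim W'" and u0: "u0 \<in> U" "u0 \<noteq> 0"
  obtains k where "k \<in> SO" "\<And>u. u \<in> U \<Longrightarrow> k *v u \<in> U'" "\<And>w. w \<in> W \<Longrightarrow> k *v w \<in> W'"
proof -
  note sub = orthogonal_decomposition_subspace[OF od] orthogonal_decomposition_subspace[OF od']
  obtain f where f: "linear f" "f ` U = U'" "\<And>x. x \<in> U \<Longrightarrow> norm (f x) = norm x"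
    using isometry_subspaces[OF sub(1,3) dims(1)] by blast
  obtain g where g: "linear g" "g ` W = W'" "\<And>x. x \<in> W \<Longrightarrow> norm (g x) = norm x"
    using isometry_subspaces[OF sub(2,4) dims(2)] by blast
  obtain P where P: "\<And>u. u \<in> U \<Longrightarrow> P *v u = u" "\<And>w. w \<in> W \<Longrightarrow> P *v w = 0"
    using orthogonal_decomposition_projection[OF od] by metis
  define M where "M = (\<lambda>x. f (P *v x) + g (x - P *v x))"
  have lin: "linear M"
    unfolding M_def
    by (rule linearI) (simp_all add: matrix_vector_right_distrib matrix_vector_mult_scaleR
        linear_add[OF f(1)] linear_add[OF g(1)] linear_diff[OF g(1)] linear_scale[OF f(1)]
        linear_scale[OF g(1)] algebra_simps)
  have MU: "M u = f u" if "u \<in> U" for u using P that by (simp add: M_def linear_0[OF g(1)])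
  have MW: "M w = g w" if "w \<in> W" for w using P that by (simp add: M_def linear_0[OF f(1)])
  have "norm (M x) = norm x" for x
  proof -
    obtain u w where uw: "u \<in> U" "w \<in> W" "x = u + w"
      using orthogonal_decomposition_sum[OF od] by metis
    have "M x = f u + g w" using uw by (simp add: linear_add[OF lin] MU MW)
    moreover have "f u \<in> U'" "g w \<in> W'" using uw f g by blast+
    then have "f u \<bullet> g w = 0" using orthogonal_decomposition_inner[OF od'] by blast
    moreover have "u \<bullet> w = 0" using orthogonal_decomposition_inner[OF od] uw by blast
    ultimately have "(norm (M x))\<^sup>2 = (norm x)\<^sup>2"
      using f(3)[OF uw(1)] g(3)[OF uw(2)] uw(3)
      by (simp add: norm_add_Pythagorean orthogonal_def)
    then show ?thesis by simp
  qed
  then have "orthogonal_transformation M" using lin by (simp add: orthogonal_transformation)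
  then have orth: "orthogonal_matrix (matrix M)" using orthogonal_transformation_matrix by blast
  have mM: "matrix M *v x = M x" for x using lin by simp
  have maps: "matrix M *v u \<in> U'" "matrix M *v w \<in> W'" if "u \<in> U" "w \<in> W" for u w
    using that f(2) g(2) by (auto simp: mM MU MW)
  have zero: "0 \<in> U" "0 \<in> W" using sub subspace_0 by blast+
  consider "det (matrix M) = 1" | "det (matrix M) = -1"
    using det_orthogonal_matrix[OF orth] by blast
  then show ?thesis
  proof cases
    case 1
    then show ?thesis using that[of "matrix M"] SO_I[OF orth] maps zero by blast
  next
    case 2
    define k where "k = matrix M ** reflection u0"
    have "k \<in> SO"
      using 2 u0 unfolding k_def
      by (intro SO_I orthogonal_matrix_mul orth orthogonal_reflection) (simp_all add: det_mul det_reflection)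
    moreover have "k *v u \<in> U'" if "u \<in> U" for u
    proof -
      have "reflection u0 *v u \<in> U"
        unfolding reflection_apply by (intro subspace_diff subspace_scale sub that u0)
      then show ?thesis
        unfolding k_def matrix_vector_mul_assoc[symmetric] using maps zero by blast
    qed
    moreover have "k *v w \<in> W'" if "w \<in> W" for w
    proof -
      have "w \<bullet> u0 = 0"
        using orthogonal_decomposition_inner[OF od u0(1) that] by (simp add: inner_commute)
      then have "reflection u0 *v w = w" by (simp add: reflection_apply)
      then show ?thesis
        unfolding k_def matrix_vector_mul_assoc[symmetric] using maps zero that by simp
    qed
    ultimately show ?thesis using that by blast
  qed
qed

section \<open>The rotation groups of the summands\<close>

lemma SO_sub_iff:
  assumes "orthogonal_decomposition U W"
  shows "A \<in> SO_sub U \<longleftrightarrow> A \<in> SO \<and> (\<forall>w\<in>W. A *v w = w)"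
  by (simp add: SO_sub_def orthogonal_decomposition_comp[OF assms])

lemma SO_sub_mult: "A \<in> SO_sub U \<Longrightarrow> B \<in> SO_sub U \<Longrightarrow> A ** B \<in> SO_sub U"
  by (auto simp: SO_sub_def SO_mult matrix_vector_mul_assoc[symmetric])

lemma SO_sub_one: "mat 1 \<in> SO_sub U"
  by (simp add: SO_sub_def SO_one)

lemma SO_sub_transpose:
  assumes "A \<in> SO_sub U"
  shows "transpose A \<in> SO_sub U"
  unfolding SO_sub_def
proof (intro CollectI conjI ballI)
  have A: "A \<in> SO" using assms by (simp add: SO_sub_def)
  then show "transpose A \<in> SO" by (rule SO_transpose)
  fix x assume "x \<in> orthogonal_comp U"
  then have "transpose A *v (A *v x) = transpose A *v x" using assms by (simp add: SO_sub_def)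
  then show "transpose A *v x = x"
    unfolding matrix_vector_mul_assoc SO_D[OF A] by simp
qed

lemma SO_sub_preserves:
  assumes "orthogonal_decomposition U W" "A \<in> SO_sub U" "u \<in> U"
  shows "A *v u \<in> U"
proof (rule orthogonal_decomposition_memI[OF assms(1)])
  fix w assume "w \<in> W"
  then have "(A *v u) \<bullet> w = (A *v u) \<bullet> (A *v w)"
    using assms SO_sub_iff by metis
  also have "\<dots> = u \<bullet> w" using assms(2) by (simp add: SO_sub_def SO_inner)
  also have "\<dots> = 0" using assms \<open>w \<in> W\<close> orthogonal_decomposition_inner by blast
  finally show "(A *v u) \<bullet> w = 0" .
qed

lemma SO_sub_commute:
  assumes od: "orthogonal_decomposition U W" and A: "A \<in> SO_sub U" and B: "B \<in> SO_sub W"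
  shows "A ** B = B ** A"
proof (rule matrix_eq_on_decomposition[OF od])
  have od': "orthogonal_decomposition W U" by (rule orthogonal_decomposition_sym[OF od])
  have fA: "A *v w = w" if "w \<in> W" for w using A that SO_sub_iff[OF od] by blast
  have fB: "B *v u = u" if "u \<in> U" for u using B that SO_sub_iff[OF od'] by blast
  show "A ** B *v u = B ** A *v u" if "u \<in> U" for u
    using that SO_sub_preserves[OF od A that] by (simp add: matrix_vector_mul_assoc[symmetric] fB)
  show "A ** B *v w = B ** A *v w" if "w \<in> W" for w
    using that SO_sub_preserves[OF od' B that] by (simp add: matrix_vector_mul_assoc[symmetric] fA)
qed

lemma compact_SO_sub: "compact (SO_sub U :: (real^'n^'n) set)"
proof -
  have "closed {A :: real^'n^'n. A *v x = x}" for x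
    unfolding matrix_vector_mult_def by (intro closed_Collect_eq continuous_intros)
  then have "closed (\<Inter>x\<in>orthogonal_comp U. {A :: real^'n^'n. A *v x = x})"
    by blast
  moreover have "SO_sub U = SO \<inter> (\<Inter>x\<in>orthogonal_comp U. {A :: real^'n^'n. A *v x = x})"
    by (auto simp: SO_sub_def)
  ultimately show ?thesis
    using compact_Int_closed[OF compact_SO] by simp
qed

text \<open>Moving \<open>w\<close> to \<open>v\<close> inside \<open>U - {0}\<close> turns \<open>s\<^sub>v s\<^sub>w B\<close> into \<open>s\<^sub>v s\<^sub>v B = B\<close>, where \<open>s\<^sub>v\<close> denotes the
  reflection in \<open>v\<close>. Along the path the determinant stays \<open>1\<close>, since it is a product of two reflections
  and \<open>B\<close>.\<close>

lemma connected_component_reflections: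
  fixes v w :: "real^'n"
  assumes od: "orthogonal_decomposition U W" and v: "v \<in> U" "v \<noteq> 0" and w: "w \<in> U" "w \<noteq> 0"
    and B: "B \<in> SO_sub U"
  shows "connected_component (SO_sub U) B (reflection v ** (reflection w ** B))"
proof -
  \<comment> \<open>Replacing \<open>w\<close> by \<open>-w\<close> keeps the segment from \<open>w\<close> to \<open>v\<close> away from the origin.\<close>
  define w' where "w' = (if v \<bullet> w \<ge> 0 then w else - w)"
  have w': "w' \<in> U" "w' \<noteq> 0" "reflection w' = reflection w" "v \<bullet> w' \<ge> 0"
    using w subspace_neg[OF orthogonal_decomposition_subspace(1)[OF od]]
    by (simp_all add: w'_def reflection_minus)
  define c where "c = (\<lambda>t::real. (1 - t) *\<^sub>R w' + t *\<^sub>R v)"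
  have cU: "c t \<in> U" for t
    using orthogonal_decomposition_subspace(1)[OF od] v w'
    unfolding c_def by (simp add: subspace_add subspace_scale)
  have c0: "c t \<noteq> 0" if "t \<in> {0..1}" for t
  proof (cases "t = 0")
    case False
    have "v \<bullet> c t = (1 - t) * (v \<bullet> w') + t * (v \<bullet> v)"
      by (simp add: c_def inner_add_right)
    also have "\<dots> > 0" using that False w' v by (simp add: add_nonneg_pos)
    finally show ?thesis by auto
  qed (use w' in \<open>simp add: c_def\<close>)
  define f where "f = (\<lambda>t. reflection v ** (reflection (c t) ** B))"
  have refl_fix: "reflection u *v x = x" if "u \<in> U" "x \<in> W" for u x
    using orthogonal_decomposition_inner[OF od that] by (simp add: reflection_apply inner_commute)
  have "continuous_on {0..1} f"
    unfolding f_def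
    by (intro continuous_on_matrix_mult continuous_on_const continuous_on_reflection c0)
      (auto simp: c_def intro!: continuous_intros)
  then have "connected (f ` {0..1})"
    by (intro connected_continuous_image) auto
  moreover have "f ` {0..1} \<subseteq> SO_sub U"
  proof
    fix M assume "M \<in> f ` {0..1}"
    then obtain t where t: "t \<in> {0..1}" "M = f t" by blast
    have "orthogonal_matrix M" unfolding t f_def
      by (intro orthogonal_matrix_mul orthogonal_reflection v c0 t SO_D) (use B in \<open>simp add: SO_sub_def\<close>)
    moreover have "det M = 1"
      using SO_D(1)[of B] B unfolding t f_def SO_sub_def
      by (simp add: det_mul det_reflection v c0[OF t(1)])
    moreover have "M *v x = x" if "x \<in> W" for x
      unfolding t f_def using that B SO_sub_iff[OF od]
      by (simp add: matrix_vector_mul_assoc[symmetric] refl_fix v cU)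
    ultimately show "M \<in> SO_sub U" using SO_sub_iff[OF od] SO_I by blast
  qed
  moreover have "f 0 = reflection v ** (reflection w ** B)"
    by (simp add: f_def c_def w')
  moreover have "f 1 = B"
    using v by (simp add: f_def c_def matrix_mul_assoc reflection_involution)
  ultimately show ?thesis
    unfolding connected_component_def by (intro exI[of _ "f ` {0..1}"]) (force simp: image_iff)
qed

text \<open>Two steps of the Cartan--Dieudonne reduction write \<open>A \<noteq> 1\<close> as \<open>s\<^sub>v s\<^sub>w B\<close> with \<open>B \<in> SO(U)\<close> fixing more
  vectors than \<open>A\<close>; a second step is possible because after one reflection the determinant is \<open>-1\<close>, so that
  the matrix is still not the identity. By the preceding lemma \<open>A\<close> can be joined to \<open>B\<close>, and induction on the
  codimension of the fixed space joins it to the identity.\<close>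

lemma connected_SO_sub:
  fixes U :: "(real^'n) set"
  assumes od: "orthogonal_decomposition U W"
  shows "connected (SO_sub U)"
proof -
  have "connected_component (SO_sub U) (mat 1) A" if "A \<in> SO_sub U" for A
    using that
  proof (induction "CARD('n) - dim {x. A *v x = x}" arbitrary: A rule: less_induct)
    case less
    show ?case
    proof (cases "A = mat 1")
      case True
      then show ?thesis using less.prems connected_component_refl by blast
    next
      case False
      have A: "orthogonal_matrix A" "det A = 1" and fixA: "\<And>w. w \<in> W \<Longrightarrow> A *v w = w"
        using less.prems SO_sub_iff[OF od] SO_D by blast+
      obtain x where x: "A *v x \<noteq> x" using False by (auto simp: matrix_eq)
      define v where "v = A *v x - x"
      define A' where "A' = reflection v ** A"
      note r = reflection_shrinks[OF A(1) x, folded v_def, folded A'_def]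
      have v: "v \<noteq> 0" using x by (simp add: v_def)
      have vU: "v \<in> U"
        using r(2) fixA by (intro orthogonal_decomposition_memI[OF od]) blast
      \<comment> \<open>The determinant leaves room for a second reflection, and two of them lead back into \<open>SO(U)\<close>.\<close>
      have "det A' = -1" using v A by (simp add: A'_def det_mul det_reflection)
      then have "A' \<noteq> mat 1" by auto
      then obtain y where y: "A' *v y \<noteq> y" by (auto simp: matrix_eq)
      define w where "w = A' *v y - y"
      define B where "B = reflection w ** A'"
      note r' = reflection_shrinks[OF r(4) y, folded w_def, folded B_def]
      have w: "w \<noteq> 0" using y by (simp add: w_def)
      have wU: "w \<in> U"
        using r'(2) r(3) fixA by (intro orthogonal_decomposition_memI[OF od]) blast
      have "det B = 1" using w \<open>det A' = -1\<close> by (simp add: B_def det_mul det_reflection)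
      then have "B \<in> SO" using r'(4) SO_I by blast
      moreover have "B *v w = w" if "w \<in> W" for w
        using r'(3)[OF r(3)[OF fixA[OF that]]] .
      ultimately have B: "B \<in> SO_sub U"
        using SO_sub_iff[OF od] by blast
      have "dim {x. B *v x = x} \<le> CARD('n)"
        using dim_subset_UNIV[of "{x. B *v x = x}"] by simp
      then have "CARD('n) - dim {x. B *v x = x} < CARD('n) - dim {x. A *v x = x}"
        using r(5) r'(5) by linarith
      from less.hyps[OF this B] have "connected_component (SO_sub U) (mat 1) B" .
      moreover have "reflection v ** (reflection w ** B) = A"
        using v w by (simp add: B_def A'_def matrix_mul_assoc reflection_involution
            reflection_involution[THEN arg_cong[of _ _ "\<lambda>M. Q ** M" for Q],
              unfolded matrix_mul_assoc matrix_mul_rid])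
      then have "connected_component (SO_sub U) B A"
        using connected_component_reflections[OF od vU v wU w B] by simp
      ultimately show ?thesis by (rule connected_component_trans)
    qed
  qed
  then show ?thesis
    unfolding connected_iff_connected_component
    by (blast intro: connected_component_sym connected_component_trans)
qed

lemma SO_prod_subset_SO: "SO_prod U W \<subseteq> SO"
  by (auto simp: SO_prod_def SO_sub_def SO_mult)

lemma compact_connected_SO_prod:
  fixes U W :: "(real^'n) set"
  assumes od: "orthogonal_decomposition U W"
  shows "compact_connected_subgroup (SO_prod U W)"
  unfolding compact_connected_subgroup_def subgroup_SL_iff
proof (intro conjI ballI)
  have od': "orthogonal_decomposition W U" by (rule orthogonal_decomposition_sym[OF od])
  show "SO_prod U W \<subseteq> {A. det A = 1}" using SO_prod_subset_SO SO_D(1) by blast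
  show "mat 1 \<in> SO_prod U W"
    unfolding SO_prod_def using SO_sub_one matrix_mul_lid by (metis (mono_tags, lifting) mem_Collect_eq)
  show "X ** Y \<in> SO_prod U W" if "X \<in> SO_prod U W" "Y \<in> SO_prod U W" for X Y
  proof -
    from that obtain A B C D where *: "X = A ** B" "Y = C ** D"
      "A \<in> SO_sub U" "B \<in> SO_sub W" "C \<in> SO_sub U" "D \<in> SO_sub W"
      unfolding SO_prod_def by blast
    have "X ** Y = A ** (B ** C) ** D" by (simp add: * matrix_mul_assoc)
    also have "B ** C = C ** B" using * SO_sub_commute[OF od'] by blast
    finally have "X ** Y = (A ** C) ** (B ** D)" by (simp add: matrix_mul_assoc)
    then show ?thesis unfolding SO_prod_def using * SO_sub_mult by blast
  qed
  show "matrix_inv X \<in> SO_prod U W" if X: "X \<in> SO_prod U W" for X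
  proof -
    from that obtain A B where *: "X = A ** B" "A \<in> SO_sub U" "B \<in> SO_sub W"
      unfolding SO_prod_def by blast
    have "matrix_inv X = transpose X" using X SO_prod_subset_SO SO_D(3) by blast
    also have "\<dots> = transpose A ** transpose B"
      unfolding *(1) SO_sub_commute[OF od *(2,3)] by (simp add: matrix_transpose_mul)
    finally show ?thesis unfolding SO_prod_def using * SO_sub_transpose by blast
  qed
  have eq: "SO_prod U W = (\<lambda>(A, B). A ** B) ` (SO_sub U \<times> SO_sub W)"
    by (auto simp: SO_prod_def)
  have cont: "continuous_on S (\<lambda>(A, B). A ** B)" for S :: "((real^'n^'n) \<times> (real^'n^'n)) set"
    unfolding case_prod_beta by (intro continuous_on_matrix_mult continuous_intros)
  show "compact (SO_prod U W)"
    unfolding eq by (intro compact_continuous_image cont compact_Times compact_SO_sub)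
  show "connected (SO_prod U W)"
    unfolding eq
    by (intro connected_continuous_image cont connected_Times connected_SO_sub[OF od]
        connected_SO_sub[OF od'])
qed

text \<open>The invariant is the orthogonal projection onto \<open>U\<close> made traceless by a multiple of the identity. It is
  not \<open>0\<close>, for the projection has both eigenvalues \<open>0\<close> and \<open>1\<close>.\<close>

lemma SO_prod_Ad_invariant:
  fixes U W :: "(real^'n) set"
  assumes od: "orthogonal_decomposition U W" and u: "u \<in> U" "u \<noteq> 0" and w: "w \<in> W" "w \<noteq> 0"
  obtains Y where "Y \<in> Ad_invariants (SO_prod U W)" "Y \<noteq> 0"
proof -
  note od' = orthogonal_decomposition_sym[OF od]
  obtain P where P: "\<And>u. u \<in> U \<Longrightarrow> P *v u = u" "\<And>w. w \<in> W \<Longrightarrow> P *v w = 0" "transpose P = P"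
    using orthogonal_decomposition_projection[OF od] by metis
  define c where "c = trace P / CARD('n)"
  define Y where "Y = P - c *\<^sub>R mat 1"
  have "transpose Y = Y"
    by (simp add: Y_def linear_diff[OF linear_transpose] transpose_scalar P)
  moreover have "trace (c *\<^sub>R mat 1 :: real^'n^'n) = c * CARD('n)"
    by (simp add: trace_def mat_def)
  then have "trace Y = 0"
    by (simp add: Y_def trace_sub c_def)
  moreover have "h ** Y ** matrix_inv h = Y" if h: "h \<in> SO_prod U W" for h
  proof -
    obtain A B where AB: "h = A ** B" "A \<in> SO_sub U" "B \<in> SO_sub W"
      using h unfolding SO_prod_def by blast
    have hU: "h *v u \<in> U" if "u \<in> U" for u
      using that AB SO_sub_preserves[OF od AB(2)] SO_sub_iff[OF od']
      by (simp add: matrix_vector_mul_assoc[symmetric])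
    have hW: "h *v w \<in> W" if "w \<in> W" for w
      using SO_sub_preserves[OF od' AB(3) that] AB SO_sub_iff[OF od]
      by (simp add: matrix_vector_mul_assoc[symmetric])
    have "h ** P = P ** h"
      by (rule matrix_eq_on_decomposition[OF od]) (simp_all add: matrix_vector_mul_assoc[symmetric] P hU hW)
    then have "h ** Y = Y ** h"
      by (simp add: Y_def matrix_mult_simps)
    moreover have "det h = 1" using h SO_prod_subset_SO SO_D(1) by blast
    ultimately show ?thesis by (simp add: matrix_inv_mult)
  qed
  ultimately have "Y \<in> Ad_invariants (SO_prod U W)"
    by (simp add: Ad_invariants_def traceless_symmetric_def)
  moreover have "Y \<noteq> 0"
  proof
    assume "Y = 0"
    then have *: "P *v x = c *\<^sub>R x" for x
      by (simp add: Y_def scaleR_matrix_vector_assoc[symmetric])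
    have "u = c *\<^sub>R u" using *[of u] P(1)[OF u(1)] by simp
    moreover have "c *\<^sub>R w = 0" using *[of w] P(2)[OF w(1)] by simp
    then have "c = 0" using w(2) by simp
    ultimately show False using u(2) by simp
  qed
  ultimately show ?thesis using that by blast
qed

text \<open>The element \<open>A\<close> is \<open>h\<close> on \<open>U\<close> and the identity on \<open>W\<close>. It depends continuously on \<open>h\<close>, its determinant is
  \<open>\<plusminus>1\<close>, and it is the identity for \<open>h = 1\<close>; connectedness of \<open>H\<close> excludes the value \<open>-1\<close>.\<close>

lemma restrict_to_SO_sub:
  fixes H :: "(real^'n^'n) set"
  assumes H: "subgroup H SL" "connected H" "H \<subseteq> SO" and od: "orthogonal_decomposition U W"
    and U: "\<And>h u. h \<in> H \<Longrightarrow> u \<in> U \<Longrightarrow> h *v u \<in> U" and h: "h \<in> H"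
  obtains A where "A \<in> SO_sub U" "\<And>u. u \<in> U \<Longrightarrow> A *v u = h *v u"
proof -
  obtain P where P: "\<And>u. u \<in> U \<Longrightarrow> P *v u = u" "\<And>w. w \<in> W \<Longrightarrow> P *v w = 0"
    using orthogonal_decomposition_projection[OF od] by metis
  define A where "A = (\<lambda>h. h ** P + (mat 1 - P))"
  have Au: "A h *v u = h *v u" if "u \<in> U" for h u
    by (simp add: A_def matrix_vector_mult_add_rdistrib matrix_vector_mult_diff_rdistrib
        matrix_vector_mul_assoc[symmetric] P that)
  have Aw: "A h *v w = w" if "w \<in> W" for h w
    by (simp add: A_def matrix_vector_mult_add_rdistrib matrix_vector_mult_diff_rdistrib
        matrix_vector_mul_assoc[symmetric] P that)
  have orth: "orthogonal_matrix (A h)" if h: "h \<in> H" for h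
    unfolding orthogonal_matrix_iff_inner
  proof (intro allI)
    fix x y
    obtain u w where x: "u \<in> U" "w \<in> W" "x = u + w"
      using orthogonal_decomposition_sum[OF od] by metis
    obtain u' w' where y: "u' \<in> U" "w' \<in> W" "y = u' + w'"
      using orthogonal_decomposition_sum[OF od] by metis
    note 0 = orthogonal_decomposition_inner[OF od]
    have "(h *v u) \<bullet> (h *v u') = u \<bullet> u'" using h H(3) SO_inner by blast
    then show "(A h *v x) \<bullet> (A h *v y) = x \<bullet> y"
      using 0[OF U[OF h x(1)] y(2)] 0[OF U[OF h y(1)] x(2)] 0[OF x(1) y(2)] 0[OF y(1) x(2)]
      by (simp add: x(3) y(3) matrix_vector_right_distrib Au Aw x y inner_add_left inner_add_right
          inner_commute)
  qed
  have conn: "connected ((\<lambda>h. det (A h)) ` H)"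
  proof (rule connected_continuous_image[OF _ H(2)])
    have "continuous_on H A"
      unfolding A_def by (intro continuous_intros continuous_on_matrix_mult)
    then show "continuous_on H (\<lambda>h. det (A h))"
      by (rule continuous_on_compose2[OF continuous_on_det[of UNIV]]) simp
  qed
  have "A (mat 1) = mat 1" by (simp add: A_def)
  moreover have "mat 1 \<in> H" by (rule subgroup_SL_D(2)[OF H(1)])
  ultimately have one: "1 \<in> (\<lambda>h. det (A h)) ` H" by (metis det_I imageI)
  have "det (A h) \<noteq> -1"
  proof
    assume "det (A h) = -1"
    then have "-1 \<in> (\<lambda>h. det (A h)) ` H" using h by (metis imageI)
    then have "0 \<in> (\<lambda>h. det (A h)) ` H"
      using connectedD_interval[OF conn _ one, of "-1" 0] by simp
    then obtain h0 where "h0 \<in> H" "det (A h0) = 0" by force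
    then show False using det_orthogonal_matrix[OF orth] by force
  qed
  then have "A h \<in> SO" using det_orthogonal_matrix[OF orth[OF h]] SO_I[OF orth[OF h]] by blast
  then show ?thesis using that[of "A h"] SO_sub_iff[OF od] Au Aw by blast
qed

text \<open>\<open>H\<close> preserves \<open>W\<close> as well, because it contains the transposes of its elements; so the preceding lemma applies
  to both summands.\<close>

lemma subset_SO_prod:
  fixes H :: "(real^'n^'n) set"
  assumes H: "subgroup H SL" "connected H" "H \<subseteq> SO" and od: "orthogonal_decomposition U W"
    and U: "\<And>h u. h \<in> H \<Longrightarrow> u \<in> U \<Longrightarrow> h *v u \<in> U"
  shows "H \<subseteq> SO_prod U W"
proof
  fix h assume h: "h \<in> H"
  note od' = orthogonal_decomposition_sym[OF od]
  have W: "h *v w \<in> W" if h: "h \<in> H" "w \<in> W" for h w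
  proof -
    have "transpose h \<in> H"
      using subgroup_SL_D(4)[OF H(1) h(1)] H(3) h(1) SO_D(3)[of h] by auto
    from transpose_maps_complement[OF od od U[OF this] h(2)] show ?thesis by simp
  qed
  obtain A where A: "A \<in> SO_sub U" "\<And>u. u \<in> U \<Longrightarrow> A *v u = h *v u"
    using restrict_to_SO_sub[OF H od U h] by blast
  obtain B where B: "B \<in> SO_sub W" "\<And>w. w \<in> W \<Longrightarrow> B *v w = h *v w"
    using restrict_to_SO_sub[OF H od' W h] by blast
  have "h = A ** B"
  proof (rule matrix_eq_on_decomposition[OF od])
    show "h *v u = A ** B *v u" if "u \<in> U" for u
      using that A B SO_sub_iff[OF od'] by (simp add: matrix_vector_mul_assoc[symmetric])
    show "h *v w = A ** B *v w" if "w \<in> W" for w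
      using that A B W[OF h that] SO_sub_iff[OF od] by (simp add: matrix_vector_mul_assoc[symmetric])
  qed
  then show "h \<in> SO_prod U W" unfolding SO_prod_def using A B by blast
qed

lemma SO_sub_conjugate:
  fixes k :: "real^'n^'n"
  assumes od: "orthogonal_decomposition U W" and od': "orthogonal_decomposition U' W'"
    and k: "k \<in> SO" "\<And>u. u \<in> U \<Longrightarrow> k *v u \<in> U'" and A: "A \<in> SO_sub U"
  shows "k ** A ** transpose k \<in> SO_sub U'"
  unfolding SO_sub_iff[OF od']
proof (intro conjI ballI)
  have AW: "A \<in> SO" "\<And>w. w \<in> W \<Longrightarrow> A *v w = w" using A SO_sub_iff[OF od] by blast+
  then show "k ** A ** transpose k \<in> SO" using k by (intro SO_mult SO_transpose)
  fix w assume "w \<in> W'"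
  then have "A *v (transpose k *v w) = transpose k *v w"
    by (intro AW transpose_maps_complement[OF od od' k(2)])
  then have "(k ** A ** transpose k) *v w = (k ** transpose k) *v w"
    by (simp only: matrix_vector_mul_assoc[symmetric])
  then show "(k ** A ** transpose k) *v w = w" by (simp add: SO_D(4)[OF k(1)])
qed

lemma SO_prod_conjugate:
  fixes k :: "real^'n^'n"
  assumes od: "orthogonal_decomposition U W" and od': "orthogonal_decomposition U' W'"
    and k: "k \<in> SO" "\<And>u. u \<in> U \<Longrightarrow> k *v u \<in> U'" "\<And>w. w \<in> W \<Longrightarrow> k *v w \<in> W'"
  shows "SO_prod U' W' = (\<lambda>h. k ** h ** transpose k) ` SO_prod U W"
proof -
  have sub: "(\<lambda>h. k ** h ** transpose k) ` SO_prod U W \<subseteq> SO_prod U' W'"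
    if od: "orthogonal_decomposition U W" and od': "orthogonal_decomposition U' W'"
      and k: "k \<in> SO" "\<And>u. u \<in> U \<Longrightarrow> k *v u \<in> U'" "\<And>w. w \<in> W \<Longrightarrow> k *v w \<in> W'"
    for U W U' W' :: "(real^'n) set" and k :: "real^'n^'n"
  proof clarify
    fix h assume "h \<in> SO_prod U W"
    then obtain A B where AB: "h = A ** B" "A \<in> SO_sub U" "B \<in> SO_sub W"
      unfolding SO_prod_def by blast
    have "(k ** A ** transpose k) ** (k ** B ** transpose k) =
        k ** A ** (transpose k ** k) ** B ** transpose k"
      by (simp only: matrix_mul_assoc)
    also have "\<dots> = k ** h ** transpose k"
      by (simp add: AB(1) SO_D(5)[OF k(1)] matrix_mul_assoc)
    finally show "k ** h ** transpose k \<in> SO_prod U' W'"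
      unfolding SO_prod_def
      using SO_sub_conjugate[OF od od' k(1,2) AB(2)]
        SO_sub_conjugate[OF orthogonal_decomposition_sym[OF od] orthogonal_decomposition_sym[OF od'] k(1,3) AB(3)]
      by (metis (mono_tags, lifting) mem_Collect_eq)
  qed
  show ?thesis
  proof
    show "(\<lambda>h. k ** h ** transpose k) ` SO_prod U W \<subseteq> SO_prod U' W'"
      by (rule sub[OF od od' k])
    show "SO_prod U' W' \<subseteq> (\<lambda>h. k ** h ** transpose k) ` SO_prod U W"
    proof
      fix h assume h: "h \<in> SO_prod U' W'"
      have "transpose k ** h ** transpose (transpose k) \<in> SO_prod U W"
        using sub[OF od' od SO_transpose[OF k(1)]] h
          transpose_maps_complement[OF od od' k(2)]
          transpose_maps_complement[OF orthogonal_decomposition_sym[OF od] orthogonal_decomposition_sym[OF od'] k(3)]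
        by blast
      moreover have "k ** (transpose k ** h ** k) ** transpose k = (k ** transpose k) ** h ** (k ** transpose k)"
        by (simp only: matrix_mul_assoc)
      then have "k ** (transpose k ** h ** k) ** transpose k = h"
        by (simp add: SO_D(4)[OF k(1)])
      ultimately show "h \<in> (\<lambda>h. k ** h ** transpose k) ` SO_prod U W"
        by (intro image_eqI[of _ _ "transpose k ** h ** k"]) simp_all
    qed
  qed
qed

section \<open>Tangent spaces of matrix groups\<close>

lemma tangent_space_image:
  assumes "bounded_linear f" "v \<in> tangent_space S x"
  shows "f v \<in> tangent_space (f ` S) (f x)"
proof -
  obtain \<gamma> where \<gamma>: "\<gamma> 0 = x" "range \<gamma> \<subseteq> S" "(\<gamma> has_vector_derivative v) (at 0)"
    using assms(2) unfolding tangent_space_def by blast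
  have "((\<lambda>t. f (\<gamma> t)) has_vector_derivative f v) (at 0)"
    by (rule bounded_linear.has_vector_derivative[OF assms(1) \<gamma>(3)])
  then show ?thesis
    unfolding tangent_space_def using \<gamma> by (intro CollectI exI[of _ "\<lambda>t. f (\<gamma> t)"]) auto
qed

lemma tangent_space_coset:
  assumes "det b = 1"
  shows "tangent_space (b <#\<^bsub>SL\<^esub> L) b = (**) b ` tangent_space L (mat 1)"
proof (intro equalityI subsetI)
  fix v assume "v \<in> tangent_space (b <#\<^bsub>SL\<^esub> L) b"
  from tangent_space_image[OF bounded_linear_mult_left[of "matrix_inv b"] this]
  have "matrix_inv b ** v \<in> tangent_space L (mat 1)"
    by (simp add: l_coset_SL image_image matrix_inv_mult[OF assms])
  then show "v \<in> (**) b ` tangent_space L (mat 1)"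
    by (rule rev_image_eqI) (simp add: matrix_inv_mult[OF assms])
next
  fix v assume "v \<in> (**) b ` tangent_space L (mat 1)"
  then obtain w where "w \<in> tangent_space L (mat 1)" "v = b ** w" by blast
  then show "v \<in> tangent_space (b <#\<^bsub>SL\<^esub> L) b"
    using tangent_space_image[OF bounded_linear_mult_left[of b]] l_coset_SL[of b L]
    by (metis matrix_mul_rid)
qed

text \<open>Conjugation by \<open>h \<in> L\<close> is a linear map that sends \<open>L\<close> into itself and fixes the identity.\<close>

lemma tangent_space_conjugate:
  assumes L: "subgroup L SL" and h: "h \<in> L" and v: "v \<in> tangent_space L (mat 1)"
  shows "h ** v ** matrix_inv h \<in> tangent_space L (mat 1)"
proof -
  have h': "det h = 1" "matrix_inv h \<in> L" using subgroup_SL_D[OF L] h by blast+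
  have "bounded_linear (\<lambda>v. h ** v ** matrix_inv h)"
    by (rule bounded_linear_compose[OF bounded_linear_mult_right bounded_linear_mult_left])
  from tangent_space_image[OF this v]
  have *: "h ** v ** matrix_inv h \<in> tangent_space ((\<lambda>v. h ** v ** matrix_inv h) ` L) (mat 1)"
    by (simp add: matrix_inv_mult[OF h'(1)])
  have "(\<lambda>v. h ** v ** matrix_inv h) ` L \<subseteq> L"
    using subgroup_SL_D(3)[OF L] h h' by blast
  with * show ?thesis unfolding tangent_space_def by blast
qed

text \<open>A product of curves has the sum of the velocities as its velocity at the identity, and a linear change of
  the parameter multiplies the velocity. This subspace is the Lie algebra of \<open>L\<close>.\<close>

lemma subspace_tangent_space:
  assumes "subgroup L SL"
  shows "subspace (tangent_space L (mat 1))"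
  unfolding subspace_def
proof (intro conjI ballI allI)
  have L: "mat 1 \<in> L" "\<And>x y. x \<in> L \<Longrightarrow> y \<in> L \<Longrightarrow> x ** y \<in> L"
    using subgroup_SL_D[OF assms] by blast+
  show "0 \<in> tangent_space L (mat 1)"
    unfolding tangent_space_def using L by (intro CollectI exI[of _ "\<lambda>t. mat 1"]) auto
  fix v assume "v \<in> tangent_space L (mat 1)"
  then obtain \<gamma> where \<gamma>: "\<gamma> 0 = mat 1" "range \<gamma> \<subseteq> L" "(\<gamma> has_vector_derivative v) (at 0)"
    unfolding tangent_space_def by blast
  show "c *\<^sub>R v \<in> tangent_space L (mat 1)" for c
  proof -
    have "((*) c has_vector_derivative c) (at 0)"
      unfolding has_real_derivative_iff_has_vector_derivative[symmetric]
      by (auto intro!: derivative_eq_intros)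
    then have "((\<gamma> \<circ> (*) c) has_vector_derivative c *\<^sub>R v) (at 0)"
      using \<gamma>(3) by (intro vector_diff_chain_at) simp_all
    then show ?thesis
      unfolding tangent_space_def using \<gamma> by (intro CollectI exI[of _ "\<gamma> \<circ> (*) c"]) auto
  qed
  fix w assume "w \<in> tangent_space L (mat 1)"
  then obtain \<delta> where \<delta>: "\<delta> 0 = mat 1" "range \<delta> \<subseteq> L" "(\<delta> has_vector_derivative w) (at 0)"
    unfolding tangent_space_def by blast
  have "((\<lambda>t. \<gamma> t ** \<delta> t) has_vector_derivative \<gamma> 0 ** w + v ** \<delta> 0) (at 0)"
    by (rule bounded_bilinear.has_vector_derivative[OF bounded_bilinear_matrix_mult \<gamma>(3) \<delta>(3)])
  then have "((\<lambda>t. \<gamma> t ** \<delta> t) has_vector_derivative v + w) (at 0)"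
    by (simp add: \<gamma> \<delta> add.commute)
  moreover have "\<gamma> t ** \<delta> t \<in> L" for t
    using \<gamma>(2) \<delta>(2) L(2) by blast
  ultimately show "v + w \<in> tangent_space L (mat 1)"
    unfolding tangent_space_def using \<gamma> \<delta>
    by (intro CollectI exI[of _ "\<lambda>t. \<gamma> t ** \<delta> t"]) auto
qed

lemma tangent_space_SO:
  fixes L :: "(real^'n^'n) set"
  assumes "L \<subseteq> SO" "v \<in> tangent_space L (mat 1)"
  shows "transpose v = - v"
proof -
  obtain \<gamma> where \<gamma>: "\<gamma> 0 = mat 1" "range \<gamma> \<subseteq> L" "(\<gamma> has_vector_derivative v) (at 0)"
    using assms(2) unfolding tangent_space_def by blast
  have "bounded_linear (transpose :: real^'n^'n \<Rightarrow> real^'n^'n)"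
    using linear_transpose linear_linear by blast
  then have "((\<lambda>t. transpose (\<gamma> t)) has_vector_derivative transpose v) (at 0)"
    by (rule bounded_linear.has_vector_derivative[OF _ \<gamma>(3)])
  from bounded_bilinear.has_vector_derivative[OF bounded_bilinear_matrix_mult this \<gamma>(3)]
  have "((\<lambda>t. transpose (\<gamma> t) ** \<gamma> t) has_vector_derivative v + transpose v) (at 0)"
    by (simp add: \<gamma>)
  moreover have "transpose (\<gamma> t) ** \<gamma> t = mat 1" for t
    using \<gamma>(2) assms(1) SO_D(5) by blast
  ultimately have "((\<lambda>t::real. mat 1 :: real^'n^'n) has_vector_derivative v + transpose v) (at 0)"
    by simp
  then have "v + transpose v = 0"
    using vector_derivative_unique_at has_vector_derivative_const by blast
  then show ?thesis by (simp add: add_eq_0_iff)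
qed

text \<open>An elementary matrix \<open>E\<^sub>i\<^sub>j\<close> with \<open>i \<noteq> j\<close> is the velocity of the transvections \<open>1 + t E\<^sub>i\<^sub>j\<close>, and a traceless
  diagonal matrix \<open>D\<close> is the velocity of \<open>exp (t D)\<close>, whose determinant is \<open>exp (t trace D) = 1\<close>. These span
  the traceless matrices.\<close>

lemma traceless_in_tangent_space_SL:
  fixes X :: "real^'n^'n"
  assumes "trace X = 0"
  shows "X \<in> tangent_space (carrier SL) (mat 1)"
proof -
  let ?T = "tangent_space (carrier SL) (mat 1 :: real^'n^'n)"
  define E :: "'n \<Rightarrow> 'n \<Rightarrow> real^'n^'n"
    where "E = (\<lambda>i j. \<chi> k l. if k = i \<and> l = j then (1::real) else 0)"
  define D :: "real^'n^'n" where "D = (\<chi> i j. if i = j then X$i$i else 0)"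
  have sub: "subspace ?T"
    using group.subgroup_self[OF group_SL] by (rule subspace_tangent_space)
  have E: "E i j \<in> ?T" if "i \<noteq> j" for i j :: 'n
  proof -
    have "(\<chi> k. if k = i then row i (mat 1 :: real^'n^'n) + t *s row j (mat 1) else row k (mat 1))
        = mat 1 + t *\<^sub>R E i j" for t
      using that by (auto simp: vec_eq_iff E_def row_def mat_def)
    then have "det (mat 1 + t *\<^sub>R E i j) = 1" for t
      using det_row_operation[OF that, of "mat 1 :: real^'n^'n" t] by simp
    moreover have "((\<lambda>t. mat 1 + t *\<^sub>R E i j) has_vector_derivative E i j) (at 0)"
      by (auto intro!: derivative_eq_intros)
    ultimately show ?thesis
      unfolding tangent_space_def by (intro CollectI exI[of _ "\<lambda>t. mat 1 + t *\<^sub>R E i j"]) auto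
  qed
  have D: "D \<in> ?T"
  proof -
    define \<gamma> :: "real \<Rightarrow> real^'n^'n"
      where "\<gamma> = (\<lambda>t. \<chi> i j. if i = j then exp (t * X$i$i) else 0)"
    have "det (\<gamma> t) = (\<Prod>i\<in>UNIV. exp (t * X$i$i))" for t
      by (subst det_diagonal) (auto simp: \<gamma>_def)
    also have "(\<Prod>i\<in>UNIV. exp (t * X$i$i)) = exp (t * trace X)" for t
      by (simp add: exp_sum sum_distrib_left trace_def)
    finally have "det (\<gamma> t) = 1" for t
      using assms by simp
    moreover have "(\<gamma> has_vector_derivative D) (at 0)"
    proof -
      have comp: "(\<Sum>i\<in>UNIV. c i *\<^sub>R E i i)$k$l = (if k = l then c k else 0)" for c k l
      proof -
        have "(\<Sum>i\<in>UNIV. c i *\<^sub>R E i i)$k$l = (\<Sum>i\<in>UNIV. if i = k then (if k = l then c k else 0) else 0)"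
          unfolding sum_component by (rule sum.cong) (auto simp: E_def)
        then show ?thesis by simp
      qed
      have "((\<lambda>t. \<Sum>i\<in>UNIV. exp (t * X$i$i) *\<^sub>R E i i) has_vector_derivative
          (\<Sum>i\<in>UNIV. X$i$i *\<^sub>R E i i)) (at 0)"
      proof (rule has_vector_derivative_sum)
        fix i
        have "((\<lambda>t. exp (t * X$i$i)) has_real_derivative X$i$i) (at 0)"
          by (auto intro!: derivative_eq_intros)
        from has_vector_derivative_scaleR[OF this has_vector_derivative_const[of "E i i"]]
        show "((\<lambda>t. exp (t * X$i$i) *\<^sub>R E i i) has_vector_derivative X$i$i *\<^sub>R E i i) (at 0)"
          by simp
      qed
      moreover have "(\<lambda>t. \<Sum>i\<in>UNIV. exp (t * X$i$i) *\<^sub>R E i i) = \<gamma>"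
        unfolding fun_eq_iff vec_eq_iff comp \<gamma>_def by simp
      moreover have "(\<Sum>i\<in>UNIV. X$i$i *\<^sub>R E i i) = D"
        unfolding vec_eq_iff comp D_def by simp
      ultimately show ?thesis by simp
    qed
    moreover have "\<gamma> 0 = mat 1" by (simp add: \<gamma>_def mat_def vec_eq_iff)
    ultimately show ?thesis
      unfolding tangent_space_def by (intro CollectI exI[of _ \<gamma>]) auto
  qed
  have "X = D + (\<Sum>p\<in>{p. fst p \<noteq> snd p}. X$fst p$snd p *\<^sub>R E (fst p) (snd p))"
    unfolding vec_eq_iff
  proof (intro allI)
    fix k l
    have "(\<Sum>p\<in>{p. fst p \<noteq> snd p}. X$fst p$snd p *\<^sub>R E (fst p) (snd p))$k$l
        = (\<Sum>p\<in>{p. fst p \<noteq> snd p}. if p = (k, l) then X$k$l else 0)"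
      unfolding sum_component by (rule sum.cong) (auto simp: E_def)
    also have "\<dots> = (if k = l then 0 else X$k$l)"
      by (simp add: sum.delta)
    finally show "X$k$l = (D + (\<Sum>p\<in>{p. fst p \<noteq> snd p}. X$fst p$snd p *\<^sub>R E (fst p) (snd p)))$k$l"
      by (simp add: D_def)
  qed
  also have "\<dots> \<in> ?T"
    by (intro subspace_add[OF sub] D subspace_sum[OF sub] subspace_scale[OF sub] E) simp
  finally show ?thesis .
qed

lemma tangent_space_SL_translate:
  fixes a :: "real^'n^'n"
  assumes "det a = 1"
  shows "tangent_space (carrier SL) a = (**) a ` tangent_space (carrier SL) (mat 1)"
proof -
  have "a <#\<^bsub>SL\<^esub> carrier SL = carrier SL"
  proof (intro equalityI subsetI)
    fix x :: "real^'n^'n" assume "x \<in> carrier SL"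
    then show "x \<in> a <#\<^bsub>SL\<^esub> carrier SL"
      unfolding l_coset_SL using assms
      by (intro image_eqI[of _ _ "matrix_inv a ** x"]) (simp_all add: det_mul matrix_inv_mult)
  qed (auto simp: l_coset_SL det_mul assms)
  then show ?thesis using tangent_space_coset[OF assms, of "carrier SL"] by simp
qed

section \<open>Invariant Lorentzian metrics\<close>

text \<open>Equality of two vectors of \<open>G/L\<close> in terms of their left translates \<open>a\<^sup>-\<^sup>1X\<close> and \<open>b\<^sup>-\<^sup>1Y\<close> to the identity:
  these agree modulo the Lie algebra of \<open>L\<close> after the adjoint action of \<open>h = b\<^sup>-\<^sup>1a \<in> L\<close>. An
  \<open>Ad\<^sub>L\<close>-invariant form on \<open>\<gg>/\<ll>\<close> therefore takes the same values on them. Note that \<open>h\<close> depends on the base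
  points only, so that it serves for both arguments of the form.\<close>

lemma dproj_eqD:
  assumes L: "subgroup L SL" and a: "det a = 1" and b: "det b = 1"
    and eq: "dproj L a X = dproj L b Y"
  shows "matrix_inv b ** a \<in> L \<and>
    matrix_inv a ** X - matrix_inv (matrix_inv b ** a) ** (matrix_inv b ** Y) ** (matrix_inv b ** a)
      \<in> tangent_space L (mat 1)"
proof -
  have "mat 1 \<in> L" using subgroup_SL_D[OF L] by blast
  have "0 \<in> tangent_space (a <#\<^bsub>SL\<^esub> L) a"
    unfolding tangent_space_coset[OF a]
    using subspace_0[OF subspace_tangent_space[OF L]] by (force simp: matrix_mult_simps)
  then have "(a, X) \<in> dproj L a X"
    unfolding dproj_def using \<open>mat 1 \<in> L\<close> by (auto intro!: bexI[of _ "mat 1"])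
  then have "(a, X) \<in> dproj L b Y" using eq by simp
  then obtain h t where h: "h \<in> L" "a = b ** h" and t: "t \<in> tangent_space L (mat 1)" "X - Y ** h = a ** t"
    unfolding dproj_def by (auto simp: tangent_space_coset[OF a])
  have h': "h = matrix_inv b ** a"
    using h by (simp add: matrix_inv_mult[OF b])
  have dh: "det h = 1" using subgroup_SL_D[OF L] h by blast
  have inva: "matrix_inv a = matrix_inv h ** matrix_inv b"
    using matrix_inv_product[OF b dh] h(2) by simp
  have "t = matrix_inv a ** (X - Y ** h)"
    by (simp add: t matrix_inv_mult[OF a])
  also have "\<dots> = matrix_inv a ** X - matrix_inv h ** (matrix_inv b ** Y) ** h"
    by (simp add: matrix_mult_simps) (simp add: inva matrix_mul_assoc)
  finally show ?thesis using t h unfolding h'[symmetric] by simp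
qed

text \<open>A vector along the fibre \<open>aL\<close> projects to zero. Conversely put: for a vector \<open>Y\<close> that does not project to zero
  the component of \<open>a\<^sup>-\<^sup>1Y\<close> orthogonal to the Lie algebra is non-zero, which is what positivity of the metric needs.\<close>

lemma dproj_eq_0:
  assumes L: "subgroup L SL" and a: "det a = 1" and Y: "matrix_inv a ** Y \<in> tangent_space L (mat 1)"
  shows "dproj L a Y = dproj L a 0"
proof -
  have "Z - Y ** h \<in> tangent_space (b <#\<^bsub>SL\<^esub> L) b \<longleftrightarrow> Z - 0 ** h \<in> tangent_space (b <#\<^bsub>SL\<^esub> L) b"
    if h: "h \<in> L" and b: "b = a ** h" for b Z h
  proof -
    have h': "det h = 1" "matrix_inv h \<in> L" using subgroup_SL_D[OF L] h by blast+
    have db: "det b = 1" using h' a by (simp add: b det_mul)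
    have "matrix_inv h ** (matrix_inv a ** Y) ** matrix_inv (matrix_inv h) \<in> tangent_space L (mat 1)"
      by (rule tangent_space_conjugate[OF L h'(2) Y])
    moreover have "matrix_inv (matrix_inv h) = h"
      by (rule matrix_inv_matrix_inv[OF h'(1)])
    moreover have "Y ** h = b ** (matrix_inv h ** (matrix_inv a ** Y) ** h)"
      by (simp add: b matrix_mul_assoc matrix_inv_mult[OF h'(1)] matrix_inv_mult[OF a])
    ultimately have Yh: "Y ** h \<in> tangent_space (b <#\<^bsub>SL\<^esub> L) b"
      unfolding tangent_space_coset[OF db] by auto
    have "subspace (tangent_space (b <#\<^bsub>SL\<^esub> L) b)"
      unfolding tangent_space_coset[OF db]
      by (intro linear_subspace_image subspace_tangent_space L bounded_linear.linear[OF bounded_linear_mult_left])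
    from subspace_add[OF this _ Yh] subspace_diff[OF this _ Yh] show ?thesis
      by (force simp: matrix_mult_simps)
  qed
  then show ?thesis unfolding dproj_def by blast
qed

lemma Ck_on_const: "Ck_on k (\<lambda>x. c) S"
  by (induction k arbitrary: c) (simp_all add: frechet_derivative_const)

lemma smooth_on_SL_const:
  assumes "\<And>a. det a = 1 \<Longrightarrow> f a = c"
  shows "smooth_on_SL f"
  unfolding smooth_on_SL_def
  by (intro exI[of _ UNIV] exI[of _ "\<lambda>_. c"]) (simp add: Ck_on_const assms)

text \<open>In the form \<open>Q Y Z = \<langle>\<pi> Y, \<pi> Z\<rangle> - 2 \<langle>E, Y\<rangle> \<langle>E, Z\<rangle>\<close> the factor \<open>2\<close> makes \<open>Q E E = -1\<close>, because \<open>E\<close> is a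
  unit vector with \<open>\<pi> E = E\<close>. For the same reason \<open>Q E Y = -\<langle>E, Y\<rangle>\<close>, so on the \<open>Q\<close>-orthogonal complement of
  \<open>E\<close> the form reduces to \<open>|\<pi> Y|\<^sup>2\<close>. The metric takes the value of \<open>Q\<close> on the left translates of its
  arguments to the identity; on left invariant fields it is constant, hence smooth.\<close>

lemma admissible_if_Ad_invariant:
  fixes L :: "(real^'n^'n) set"
  assumes L: "compact_connected_subgroup L" and SO: "L \<subseteq> SO"
    and X0: "X0 \<in> Ad_invariants L" "X0 \<noteq> 0"
  shows "admissible L"
proof -
  let ?T = "tangent_space L (mat 1)"
  have sg: "subgroup L SL" using L by (simp add: compact_connected_subgroup_def)
  have subT: "subspace ?T" by (rule subspace_tangent_space[OF sg])
  obtain \<pi> where lin: "linear \<pi>" and \<pi>: "\<And>x. x - \<pi> x \<in> ?T" "\<And>x t. t \<in> ?T \<Longrightarrow> \<pi> x \<bullet> t = 0"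
    and uniq: "\<And>x y. x - y \<in> ?T \<Longrightarrow> (\<And>t. t \<in> ?T \<Longrightarrow> y \<bullet> t = 0) \<Longrightarrow> \<pi> x = y"
    using orthogonal_projection_exists[OF subT] by blast
  define E where "E = X0 /\<^sub>R norm X0"
  have X0': "transpose X0 = X0" "trace X0 = 0" "\<And>h. h \<in> L \<Longrightarrow> h ** X0 ** matrix_inv h = X0"
    using X0 by (auto simp: Ad_invariants_def traceless_symmetric_def)
  have E: "transpose E = E" "trace E = 0" "E \<bullet> E = 1"
    using X0 X0' by (simp_all add: E_def transpose_scalar trace_def sum_distrib_left[symmetric]
        dot_square_norm power2_eq_square flip: power2_norm_eq_inner)
  have Einv: "h ** E ** matrix_inv h = E" if "h \<in> L" for h
    using X0'(3)[OF that] by (simp add: E_def matrix_mult_simps)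
  have ET: "E \<bullet> t = 0" if "t \<in> ?T" for t
    using tangent_space_SO[OF SO that] E by (intro inner_symmetric_skew)
  have \<pi>T: "\<pi> t = 0" if "t \<in> ?T" for t
    using that by (intro uniq) simp_all
  have \<pi>E: "\<pi> E = E"
    using subspace_0[OF subT] ET by (intro uniq) simp_all
  have E\<pi>: "E \<bullet> \<pi> Y = E \<bullet> Y" for Y
    using ET[OF \<pi>(1)[of Y]] by (simp add: inner_diff_right)
  define Q where "Q = (\<lambda>Y Z. \<pi> Y \<bullet> \<pi> Z - 2 * (E \<bullet> Y) * (E \<bullet> Z))"
  have Q_sym: "Q Y Z = Q Z Y" for Y Z
    by (simp add: Q_def inner_commute)
  have Q_lin: "Q (r *\<^sub>R X + s *\<^sub>R Y) Z = r * Q X Z + s * Q Y Z" for r s X Y Z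
    by (simp add: Q_def linear_add[OF lin] linear_scale[OF lin] inner_add_left inner_add_right
        algebra_simps)
  have Q_T: "Q Y Z = Q Y' Z'" if "Y - Y' \<in> ?T" "Z - Z' \<in> ?T" for Y Y' Z Z'
    using \<pi>T[OF that(1)] \<pi>T[OF that(2)] ET[OF that(1)] ET[OF that(2)]
    by (simp add: Q_def linear_diff[OF lin] inner_diff_right)
  have Q_Ad: "Q (h ** Y ** matrix_inv h) (h ** Z ** matrix_inv h) = Q Y Z" if h: "h \<in> L" for h Y Z
  proof -
    have hSO: "h \<in> SO" and h': "det h = 1" "matrix_inv h \<in> L"
      using SO subgroup_SL_D[OF sg] h by blast+
    have "\<pi> (h ** Y ** matrix_inv h) = h ** \<pi> Y ** matrix_inv h" for Y
    proof (rule uniq)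
      have "h ** Y ** matrix_inv h - h ** \<pi> Y ** matrix_inv h = h ** (Y - \<pi> Y) ** matrix_inv h"
        by (simp add: matrix_mult_simps)
      then show "h ** Y ** matrix_inv h - h ** \<pi> Y ** matrix_inv h \<in> ?T"
        using tangent_space_conjugate[OF sg h \<pi>(1)] by metis
      fix t assume t: "t \<in> ?T"
      define t' where "t' = matrix_inv h ** t ** matrix_inv (matrix_inv h)"
      have "matrix_inv (matrix_inv h) = h"
        by (rule matrix_inv_matrix_inv[OF h'(1)])
      then have "t = h ** t' ** matrix_inv h"
        by (simp add: t'_def matrix_mul_assoc matrix_inv_mult[OF h'(1)])
      moreover have "t' \<in> ?T" unfolding t'_def by (rule tangent_space_conjugate[OF sg h'(2) t])
      ultimately show "(h ** \<pi> Y ** matrix_inv h) \<bullet> t = 0"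
        using \<pi>(2) by (simp add: inner_SO_conjugate[OF hSO])
    qed
    moreover have "E \<bullet> (h ** Y ** matrix_inv h) = E \<bullet> Y" for Y
      using inner_SO_conjugate[OF hSO, of E Y] Einv[OF h] by simp
    ultimately show ?thesis by (simp add: Q_def inner_SO_conjugate[OF hSO])
  qed
  \<comment> \<open>A tangent vector of \<open>G/L\<close> has many representatives; the choice made here is shown next to be
    immaterial, by \<open>dproj_eqD\<close> and the two invariance properties of \<open>Q\<close>.\<close>
  define m where "m = (\<lambda>C D. SOME r. \<exists>a X Y. det a = 1 \<and> C = dproj L a X \<and> D = dproj L a Y \<and>
    r = Q (matrix_inv a ** X) (matrix_inv a ** Y))"
  have m: "m (dproj L a X) (dproj L a Y) = Q (matrix_inv a ** X) (matrix_inv a ** Y)"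
    if a: "det a = 1" for a X Y
    unfolding m_def
  proof (rule some_equality)
    show "\<exists>a' X' Y'. det a' = 1 \<and> dproj L a X = dproj L a' X' \<and> dproj L a Y = dproj L a' Y' \<and>
      Q (matrix_inv a ** X) (matrix_inv a ** Y) = Q (matrix_inv a' ** X') (matrix_inv a' ** Y')"
      using a by blast
    fix r assume "\<exists>a' X' Y'. det a' = 1 \<and> dproj L a X = dproj L a' X' \<and> dproj L a Y = dproj L a' Y' \<and>
      r = Q (matrix_inv a' ** X') (matrix_inv a' ** Y')"
    then obtain b X' Y' where b: "det b = 1" "dproj L a X = dproj L b X'" "dproj L a Y = dproj L b Y'"
      "r = Q (matrix_inv b ** X') (matrix_inv b ** Y')" by blast
    define h where "h = matrix_inv b ** a"
    note * = dproj_eqD[OF sg a b(1) b(2), folded h_def] dproj_eqD[OF sg a b(1) b(3), folded h_def]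
    have hL: "h \<in> L" using * by blast
    have h': "det h = 1" "matrix_inv h \<in> L"
      using subgroup_SL_D[OF sg] hL by blast+
    have hh: "matrix_inv (matrix_inv h) = h"
      by (rule matrix_inv_matrix_inv[OF h'(1)])
    have "Q (matrix_inv a ** X) (matrix_inv a ** Y) =
        Q (matrix_inv h ** (matrix_inv b ** X') ** h) (matrix_inv h ** (matrix_inv b ** Y') ** h)"
      using * by (intro Q_T) blast+
    also have "\<dots> = r"
      using Q_Ad[OF h'(2)] b(4) by (simp add: hh)
    finally show "r = Q (matrix_inv a ** X) (matrix_inv a ** Y)" by simp
  qed
  have "lorentzian_metric L m"
    unfolding lorentzian_metric_def
  proof (intro conjI ballI allI)
    fix a :: "real^'n^'n" assume "a \<in> carrier SL"
    then have a: "det a = 1" by simp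
    show "m (dproj L a X) (dproj L a Y) = m (dproj L a Y) (dproj L a X)" for X Y
      by (simp add: m[OF a] Q_sym)
    show "m (dproj L a (r *\<^sub>R X + s *\<^sub>R Y)) (dproj L a Z) =
      r * m (dproj L a X) (dproj L a Z) + s * m (dproj L a Y) (dproj L a Z)" for X Y Z r s
      by (simp add: m[OF a] matrix_mult_simps Q_lin)
    show "\<exists>X\<in>tangent_space (carrier SL) a. m (dproj L a X) (dproj L a X) < 0 \<and>
      (\<forall>Y\<in>tangent_space (carrier SL) a.
        dproj L a Y \<noteq> dproj L a 0 \<and> m (dproj L a X) (dproj L a Y) = 0 \<longrightarrow>
        m (dproj L a Y) (dproj L a Y) > 0)"
    proof (intro bexI[of _ "a ** E"] conjI ballI impI)
      show "a ** E \<in> tangent_space (carrier SL) a"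
        unfolding tangent_space_SL_translate[OF a]
        using traceless_in_tangent_space_SL[OF E(2)] by blast
      show "m (dproj L a (a ** E)) (dproj L a (a ** E)) < 0"
        by (simp add: m[OF a] matrix_inv_mult[OF a] Q_def \<pi>E E)
      fix Y assume Y: "dproj L a Y \<noteq> dproj L a 0 \<and> m (dproj L a (a ** E)) (dproj L a Y) = 0"
      define Z where "Z = matrix_inv a ** Y"
      have "E \<bullet> Z = 0"
        using Y by (simp add: m[OF a] matrix_inv_mult[OF a] Q_def \<pi>E E E\<pi> Z_def)
      moreover have "\<pi> Z \<noteq> 0"
      proof
        assume "\<pi> Z = 0"
        then have "Z \<in> ?T" using \<pi>(1)[of Z] by simp
        then show False using dproj_eq_0[OF sg a] Y by (simp add: Z_def)
      qed
      ultimately show "m (dproj L a Y) (dproj L a Y) > 0"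
        by (simp add: m[OF a] Q_def flip: Z_def)
    qed
  next
    fix X Y
    show "smooth_on_SL (\<lambda>a. m (dproj L a (a ** X)) (dproj L a (a ** Y)))"
      by (rule smooth_on_SL_const[of _ "Q X Y"]) (simp add: m matrix_inv_mult)
  qed
  moreover have "invariant_metric L m"
    unfolding invariant_metric_def
  proof (intro ballI)
    fix g a X Y :: "real^'n^'n" assume "g \<in> carrier SL" "a \<in> carrier SL"
    then have ga: "det g = 1" "det a = 1" by simp_all
    have "matrix_inv (g ** a) ** (g ** V) = matrix_inv a ** V" for V :: "real^'n^'n"
      by (simp add: matrix_inv_product[OF ga] matrix_inv_mult[OF ga(1)] flip: matrix_mul_assoc)
    then show "m (dproj L (g ** a) (g ** X)) (dproj L (g ** a) (g ** Y)) =
        m (dproj L a X) (dproj L a Y)"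
      using ga by (simp add: m det_mul)
  qed
  ultimately show ?thesis unfolding admissible_def using L by blast
qed

section \<open>Quotients by conjugate subgroups\<close>

text \<open>The definition of \<open>C\<^sup>k\<close> iterates derivatives, so even replacing \<open>f\<close> by a function that agrees with it on \<open>S\<close>
  needs an induction: the derivatives agree on \<open>S\<close> because \<open>S\<close> is open.\<close>

lemma Ck_on_cong:
  assumes "open S" "\<And>x. x \<in> S \<Longrightarrow> f x = g x" "Ck_on k f S"
  shows "Ck_on k g S"
  using assms(2,3)
proof (induction k arbitrary: f g)
  case 0
  then show ?case using continuous_on_cong by force
next
  case (Suc k)
  have d: "(g has_derivative frechet_derivative f (at x)) (at x)" if "x \<in> S" for x
  proof (rule has_derivative_transform_within_open[OF _ assms(1) that])
    show "(f has_derivative frechet_derivative f (at x)) (at x)"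
      using Suc.prems(2) that by (simp add: frechet_derivative_works)
  qed (rule Suc.prems(1))
  have "Ck_on k (\<lambda>x. frechet_derivative g (at x) v) S" for v
  proof (rule Suc.IH)
    show "Ck_on k (\<lambda>x. frechet_derivative f (at x) v) S" using Suc.prems by simp
    show "frechet_derivative f (at x) v = frechet_derivative g (at x) v" if "x \<in> S" for x
      using frechet_derivative_at[OF d[OF that]] by simp
  qed
  then show ?case using d unfolding differentiable_def Ck_on.simps by blast
qed

lemma Ck_on_compose_linear:
  assumes l: "bounded_linear l" and S: "open S" and f: "Ck_on k f S"
  shows "Ck_on k (\<lambda>x. f (l x)) (l -` S)"
  using f
proof (induction k arbitrary: f)
  case 0
  have "continuous_on (l -` S) l" by (rule linear_continuous_on[OF l])
  then show ?case
    using continuous_on_compose2[of S f "l -` S" l] 0 by auto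
next
  case (Suc k)
  have S': "open (l -` S)"
    using S linear_continuous_on[OF l] by (simp add: open_vimage)
  have d: "((\<lambda>x. f (l x)) has_derivative (\<lambda>v. frechet_derivative f (at (l x)) (l v))) (at x)"
    if "x \<in> l -` S" for x
  proof (rule has_derivative_compose[OF bounded_linear_imp_has_derivative[OF l]])
    show "(f has_derivative frechet_derivative f (at (l x))) (at (l x))"
      using Suc.prems that by (simp add: frechet_derivative_works)
  qed
  have "Ck_on k (\<lambda>x. frechet_derivative (\<lambda>x. f (l x)) (at x) v) (l -` S)" for v
  proof (rule Ck_on_cong[OF S'])
    show "Ck_on k (\<lambda>x. frechet_derivative f (at (l x)) (l v)) (l -` S)"
      using Suc.IH[of "\<lambda>y. frechet_derivative f (at y) (l v)"] Suc.prems by simp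
    show "frechet_derivative f (at (l x)) (l v) = frechet_derivative (\<lambda>x. f (l x)) (at x) v"
      if "x \<in> l -` S" for x
      using fun_cong[OF frechet_derivative_at[OF d[OF that]], of v] .
  qed
  then show ?case using d unfolding differentiable_def Ck_on.simps by blast
qed

text \<open>Right translation by \<open>k\<close> is the restriction of a linear map of the space of matrices, so an extension of \<open>f\<close>
  composed with that map extends the translate of \<open>f\<close>.\<close>

lemma smooth_on_SL_right_translate:
  fixes k :: "real^'n^'n"
  assumes k: "det k = 1" and f: "smooth_on_SL f"
  shows "smooth_on_SL (\<lambda>g. f (g ** k))"
proof -
  obtain V F where V: "open V" "carrier SL \<subseteq> V" "\<And>j. Ck_on j F V" "\<And>g. g \<in> carrier SL \<Longrightarrow> F g = f g"
    using f unfolding smooth_on_SL_def by blast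
  have l: "bounded_linear (\<lambda>g :: real^'n^'n. g ** k)"
    by (rule bounded_bilinear.bounded_linear_left[OF bounded_bilinear_matrix_mult])
  show ?thesis
    unfolding smooth_on_SL_def
  proof (intro exI conjI allI ballI)
    show "open ((\<lambda>g. g ** k) -` V)"
      using V(1) linear_continuous_on[OF l] by (simp add: open_vimage)
    show "carrier SL \<subseteq> (\<lambda>g. g ** k) -` V"
    proof
      fix g :: "real^'n^'n" assume "g \<in> carrier SL"
      then have "g ** k \<in> carrier SL" using k by (simp add: det_mul)
      then show "g \<in> (\<lambda>g. g ** k) -` V" using V(2) by blast
    qed
    show "Ck_on j (\<lambda>g. F (g ** k)) ((\<lambda>g. g ** k) -` V)" for j
      by (rule Ck_on_compose_linear[OF l V(1,3)])
    show "F (g ** k) = f (g ** k)" if "g \<in> carrier SL" for g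
      using that k by (intro V(4)) (simp add: det_mul)
  qed
qed

text \<open>The isomorphism is \<open>C \<mapsto> C k\<^sup>-\<^sup>1\<close>. It sends \<open>gH\<close> to \<open>g k\<^sup>-\<^sup>1 (k H k\<^sup>-\<^sup>1)\<close>, commutes with left translations, and is
  covered by a right translation of \<open>G\<close>, which preserves smoothness in both directions.\<close>

lemma isomorphic_quotients_conjugate:
  fixes H :: "(real^'n^'n) set"
  assumes k: "det k = 1" and L: "L = (\<lambda>h. k ** h ** matrix_inv k) ` H"
  shows "isomorphic_quotients H L"
proof -
  let ?k' = "matrix_inv k"
  define F :: "(real^'n^'n) set \<Rightarrow> (real^'n^'n) set" where "F = (\<lambda>C. (\<lambda>x. x ** ?k') ` C)"
  define F' :: "(real^'n^'n) set \<Rightarrow> (real^'n^'n) set" where "F' = (\<lambda>C. (\<lambda>x. x ** k) ` C)"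
  have F: "F (g <#\<^bsub>SL\<^esub> H) = (g ** ?k') <#\<^bsub>SL\<^esub> L" for g
    by (auto simp: F_def L l_coset_SL image_image matrix_mul_assoc matrix_inv_mult[OF k])
  have F': "F' (g <#\<^bsub>SL\<^esub> L) = (g ** k) <#\<^bsub>SL\<^esub> H" for g
    by (auto simp: F'_def L l_coset_SL image_image matrix_mul_assoc matrix_inv_mult[OF k])
  have inv: "F' (F C) = C" "F (F' C) = C" for C
    by (simp_all add: F_def F'_def image_image matrix_inv_mult[OF k])
  have bij: "bij_betw F (lcosets\<^bsub>SL\<^esub> H) (lcosets\<^bsub>SL\<^esub> L)"
  proof (rule bij_betw_byWitness[where f' = F'])
    show "F ` (lcosets\<^bsub>SL\<^esub> H) \<subseteq> lcosets\<^bsub>SL\<^esub> L"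
    proof clarify
      fix C assume "C \<in> lcosets\<^bsub>SL\<^esub> H"
      then obtain g where "det g = 1" "C = g <#\<^bsub>SL\<^esub> H" by (auto simp: LCOSETS_def)
      then show "F C \<in> lcosets\<^bsub>SL\<^esub> L"
        unfolding LCOSETS_def by (auto simp: F det_mul matrix_inv_mult[OF k] intro!: bexI[of _ "g ** ?k'"])
    qed
    show "F' ` (lcosets\<^bsub>SL\<^esub> L) \<subseteq> lcosets\<^bsub>SL\<^esub> H"
    proof clarify
      fix C assume "C \<in> lcosets\<^bsub>SL\<^esub> L"
      then obtain g where "det g = 1" "C = g <#\<^bsub>SL\<^esub> L" by (auto simp: LCOSETS_def)
      then show "F' C \<in> lcosets\<^bsub>SL\<^esub> H"
        unfolding LCOSETS_def by (auto simp: F' det_mul k intro!: bexI[of _ "g ** k"])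
    qed
  qed (simp_all add: inv)
  have equivariant: "F (g <#\<^bsub>SL\<^esub> C) = g <#\<^bsub>SL\<^esub> F C" for g C
    by (simp add: F_def l_coset_SL image_image matrix_mul_assoc)
  have smooth: "smooth_on_quotient L f \<longleftrightarrow> smooth_on_quotient H (f \<circ> F)" for f
  proof
    assume "smooth_on_quotient L f"
    then have "smooth_on_SL (\<lambda>g. f ((g ** ?k') <#\<^bsub>SL\<^esub> L))"
      unfolding smooth_on_quotient_def
      by (rule smooth_on_SL_right_translate[OF matrix_inv_mult(7)[OF k]])
    then show "smooth_on_quotient H (f \<circ> F)"
      by (simp add: smooth_on_quotient_def F)
  next
    assume "smooth_on_quotient H (f \<circ> F)"
    then have "smooth_on_SL (\<lambda>g. f ((g ** ?k') <#\<^bsub>SL\<^esub> L))"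
      by (simp add: smooth_on_quotient_def F)
    from smooth_on_SL_right_translate[OF k this]
    show "smooth_on_quotient L f"
      by (simp add: smooth_on_quotient_def matrix_inv_mult[OF k])
  qed
  show ?thesis
    unfolding isomorphic_quotients_def using bij equivariant smooth by blast
qed

section \<open>Minimal admissible manifolds of class II\<close>

text \<open>
  Elements of \<open>H\<close> commute with \<open>X\<close> and hence preserve its eigenspaces. If the complement of the eigenspace
  \<open>U\<close> were \<open>0\<close>, then \<open>X\<close> would be a multiple of the identity, and a traceless one only for \<open>X = 0\<close>.
\<close>

lemma invariant_eigenspace_decomposition:
  fixes X :: "real^'n^'n"
  assumes H: "subgroup H SL" and X: "X \<in> Ad_invariants H" "X \<noteq> 0"
  obtains U W u w where "orthogonal_decomposition U W" "u \<in> U" "u \<noteq> 0" "w \<in> W" "w \<noteq> 0"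
    "\<And>h x. h \<in> H \<Longrightarrow> x \<in> U \<Longrightarrow> h *v x \<in> U"
proof -
  have X': "transpose X = X" "trace X = 0" "\<And>h. h \<in> H \<Longrightarrow> h ** X ** matrix_inv h = X"
    using X by (auto simp: Ad_invariants_def traceless_symmetric_def)
  obtain r u where u: "u \<noteq> 0" "X *v u = r *\<^sub>R u"
    using symmetric_eigenvector[OF X'(1)] by blast
  define U where "U = {x. X *v x = r *\<^sub>R x}"
  define W where "W = orthogonal_comp U"
  have U: "subspace U"
    by (auto simp: U_def subspace_def matrix_vector_right_distrib matrix_vector_mult_scaleR
        scaleR_add_right)
  have split: "\<exists>a\<in>U. \<exists>b\<in>W. x = a + b" for x
    using subspace_sum_orthogonal_comp[OF U] unfolding W_def by (metis UNIV_I set_plus_elim)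
  have od: "orthogonal_decomposition U W"
    unfolding orthogonal_decomposition_def
  proof (intro conjI allI)
    show "subspace U" by (rule U)
    show "subspace W" unfolding W_def by (rule subspace_orthogonal_comp)
    show "\<forall>u\<in>U. \<forall>w\<in>W. orthogonal u w" by (simp add: W_def orthogonal_comp_def)
  qed (rule split)
  have "\<exists>w\<in>W. w \<noteq> 0"
  proof (rule ccontr)
    assume W0: "\<not> (\<exists>w\<in>W. w \<noteq> 0)"
    have "X *v x = r *\<^sub>R x" for x
    proof -
      obtain a b where "a \<in> U" "b \<in> W" "x = a + b" using split by blast
      then have "x \<in> U" using W0 by (metis add_0_right)
      then show ?thesis by (simp add: U_def)
    qed
    then have Xr: "X = r *\<^sub>R mat 1"
      by (simp add: matrix_eq scaleR_matrix_vector_assoc[symmetric])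
    then have "r * CARD('n) = 0"
      using X'(2) by (simp add: trace_def mat_def)
    then show False using Xr X(2) by simp
  qed
  then obtain w where w: "w \<in> W" "w \<noteq> 0" by blast
  have "h *v x \<in> U" if h: "h \<in> H" and x: "x \<in> U" for h x
  proof -
    have "X ** h = h ** X ** matrix_inv h ** h" using X'(3)[OF h] by simp
    also have "\<dots> = h ** X" using subgroup_SL_D(1)[OF H h] by (simp add: matrix_inv_mult)
    finally have "X *v (h *v x) = h *v (X *v x)" by (simp add: matrix_vector_mul_assoc)
    then show ?thesis using x by (simp add: U_def matrix_vector_mult_scaleR)
  qed
  moreover have "u \<in> U" using u(2) by (simp add: U_def)
  ultimately show ?thesis using that od u(1) w by blast
qed

lemma orthogonal_decomposition_dim:
  fixes U W :: "(real^'n) set"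
  assumes "orthogonal_decomposition U W"
  shows "dim U + dim W = CARD('n)"
  using dim_subspace_orthogonal_to_vectors[of U UNIV] orthogonal_decomposition_subspace(1)[OF assms]
  by (simp add: orthogonal_decomposition_comp[OF assms, unfolded orthogonal_comp_def])

lemma isomorphic_to_M_SO_prod:
  fixes U W :: "(real^'n) set"
  assumes od: "orthogonal_decomposition U W" and u: "u \<in> U" "u \<noteq> 0"
  shows "isomorphic_to_M (dim U) (dim W) (SO_prod U W)"
  unfolding isomorphic_to_M_def
proof (intro allI impI)
  fix U' W' :: "(real^'n) set"
  assume *: "orthogonal_decomposition U' W' \<and> dim U' = dim U \<and> dim W' = dim W"
  then have od': "orthogonal_decomposition U' W'" by blast
  obtain k where k: "k \<in> SO" "\<And>u. u \<in> U \<Longrightarrow> k *v u \<in> U'" "\<And>w. w \<in> W \<Longrightarrow> k *v w \<in> W'"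
    using rotation_of_decompositions[OF od od' _ _ u] * by metis
  show "isomorphic_quotients (SO_prod U W) (SO_prod U' W')"
    using SO_prod_conjugate[OF od od' k] SO_D(1,3)[OF k(1)]
    by (intro isomorphic_quotients_conjugate[of k]) simp_all
qed

theorem theorem3:
  fixes H :: "(real^'n^'n) set"
  assumes "minimal_admissible H"
    and "class_II H"
  shows "\<exists>p q. p + q = CARD('n) \<and> isomorphic_to_M p q H"
proof -
  from assms(2) obtain X where X: "X \<in> Ad_invariants H" "X \<noteq> 0" and SO: "H \<subseteq> SO"
    and "admissible H"
    unfolding class_II_def by blast
  then have H: "subgroup H SL" "connected H"
    by (simp_all add: admissible_def compact_connected_subgroup_def)
  obtain U W u w where od: "orthogonal_decomposition U W"
    and u: "u \<in> U" "u \<noteq> 0" and w: "w \<in> W" "w \<noteq> 0"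
    and HU: "\<And>h x. h \<in> H \<Longrightarrow> x \<in> U \<Longrightarrow> h *v x \<in> U"
    using invariant_eigenspace_decomposition[OF H(1) X] by blast
  define L where "L = SO_prod U W"
  have "H \<subseteq> L"
    unfolding L_def by (rule subset_SO_prod[OF H SO od HU])
  moreover have L: "compact_connected_subgroup L"
    unfolding L_def by (rule compact_connected_SO_prod[OF od])
  moreover have "admissible L"
  proof -
    obtain Y where "Y \<in> Ad_invariants L" "Y \<noteq> 0"
      unfolding L_def using SO_prod_Ad_invariant[OF od u w] by blast
    then show ?thesis
      using admissible_if_Ad_invariant[OF L] SO_prod_subset_SO unfolding L_def by blast
  qed
  ultimately have "H = L"
    using assms(1) unfolding minimal_admissible_def by blast
  then show ?thesis
    using isomorphic_to_M_SO_prod[OF od u] orthogonal_decomposition_dim[OF od] L_def by blast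
qed

end
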